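(* Let $k\ge2$, $m\ge0$, $1\le s\le k$, and $N=mk+s$. For vincular patterns of length three in which exactly the first two letters are required to be adjacent, the numbers of avoiding permutations in $\mathcal{D}_{mk+s,k}$ are as follows. (1) $|\mathcal{D}_{N,k}(\underline{12}3)|=0$ if $k\ge3$ and $N\ge3$; and for $k=2$, $$|\mathcal{D}_{2m+1,2}(\underline{12}3)|=2^m m!,\qquad |\mathcal{D}_{2m+2,2}(\underline{12}3)|=\prod_{j=1}^{m}(2j+1).$$ (2) $|\mathcal{D}_{N,k}(\underline{13}2)|=\frac{s}{mk+s}\binom{mk+s}{m}$. (3) $|\mathcal{D}_{N,k}(\underline{21}3)|=\prod_{j=1}^{m}\binom{s+jk-1}{k-1}$. (4) $|\mathcal{D}_{N,k}(\underline{23}1)|=\prod_{j=0}^{m-1}(s+jk)$. (5) $|\mathcal{D}_{N,k}(\underline{31}2)|=\frac{1}{(k-1)(m+1)+1}\binom{k(m+1)}{m+1}$. (6) $|\mathcal{D}_{N,k}(\underline{32}1)|=\operatorname{LE}(P^{321}_{m,s,k})$, where $P^{321}_{m,s,k}$ is the poset obtained from the block poset $B_{m,s,k}$ by adding, for each $1\le i\le m$, the relations $x_{i+1,1}<x_{j,a}$ for every position $(j,a)$ lying strictly to the right of $x_{i+1,1}$.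
   Context: For $\pi=\pi_1\cdots\pi_N\in S_N$ let $\operatorname{Des}(\pi)=\{i\in[N-1]:\pi_i>\pi_{i+1}\}$. For $k\ge2$, $N\ge1$, let $\mathcal{D}_{N,k}=\{\pi\in S_N:\operatorname{Des}(\pi)=\{k,2k,\ldots,k\lfloor (N-1)/k\rfloor\}\}$. For $abc\in S_3$, $\pi$ contains the vincular pattern $\underline{ab}c$ if there are positions $i<i+1<j$ such that $\pi_i\pi_{i+1}\pi_j$ has the same relative order as $abc$; otherwise it avoids it. $\mathcal{D}_{N,k}(p)$ is the set of elements of $\mathcal{D}_{N,k}$ avoiding $p$. Empty products equal $1$. Write $N=mk+s$ with $1\le s\le k$, and split the positions $1,\ldots,N$ from left to right into $m$ blocks of length $k$ followed by a last block of length $s$; $x_{i,a}$ is the $a$-th position of the $i$-th block ($1\le a\le k$ for $i\le m$, $1\le a\le s$ for $i=m+1$). The block poset $B_{m,s,k}$ on the elements $x_{i,a}$ is generated by $x_{i,a}<x_{i,a+1}$ inside each block and $x_{i+1,1}<x_{i,k}$ for $1\le i\le m$. "Adding relations" to a poset means taking the transitive closure. "Left/right/earlier" refer to the order of positions $1,\ldots,N$. $\operatorname{LE}(P)$ is the number of linear extensions of a finite poset $P$. *)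

theory Defs
  imports Complex_Main "HOL-Combinatorics.Combinatorics"
begin

text \<open>An element of \<open>S\<^sub>N\<close> is a function that permutes \<open>{1..N}\<close>; its one-line notation is
  \<open>\<pi> 1, \<dots>, \<pi> N\<close>.\<close>

definition Des :: "nat \<Rightarrow> (nat \<Rightarrow> nat) \<Rightarrow> nat set" where
  "Des N \<pi> = {i \<in> {1..N - 1}. \<pi> i > \<pi> (i + 1)}"

definition D :: "nat \<Rightarrow> nat \<Rightarrow> (nat \<Rightarrow> nat) set" where
  "D N k = {\<pi>. \<pi> permutes {1..N} \<and> Des N \<pi> = (\<lambda>j. k * j) ` {1..(N - 1) div k}}"

definition same_relative_order :: "nat list \<Rightarrow> nat list \<Rightarrow> bool" where
  "same_relative_order xs ys \<longleftrightarrow> length xs = length ys \<and>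
     (\<forall>i < length xs. \<forall>j < length xs. xs ! i < xs ! j \<longleftrightarrow> ys ! i < ys ! j)"

text \<open>The pattern \<open>abc\<close> is given in one-line notation as \<open>[a, b, c]\<close>; the first two letters
  must occur in adjacent positions.\<close>

definition contains_vincular :: "nat \<Rightarrow> (nat \<Rightarrow> nat) \<Rightarrow> nat list \<Rightarrow> bool" where
  "contains_vincular N \<pi> p \<longleftrightarrow>
     (\<exists>i j. 1 \<le> i \<and> i + 1 < j \<and> j \<le> N \<and> same_relative_order [\<pi> i, \<pi> (i + 1), \<pi> j] p)"

definition D_avoiding :: "nat \<Rightarrow> nat \<Rightarrow> nat list \<Rightarrow> (nat \<Rightarrow> nat) set" where
  "D_avoiding N k p = {\<pi> \<in> D N k. \<not> contains_vincular N \<pi> p}"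

text \<open>The element \<open>x\<^bsub>i,a\<^esub>\<close> is the pair \<open>(i, a)\<close>. Posets are represented, as in
  \<^theory>\<open>HOL.Order_Relation\<close>, by their reflexive order relation on the carrier.\<close>

definition block_elems :: "nat \<Rightarrow> nat \<Rightarrow> nat \<Rightarrow> (nat \<times> nat) set" where
  "block_elems m s k = {(i, a). 1 \<le> i \<and> i \<le> m + 1 \<and> 1 \<le> a \<and> a \<le> (if i \<le> m then k else s)}"

definition block_pos :: "nat \<Rightarrow> nat \<times> nat \<Rightarrow> nat" where
  "block_pos k x = (fst x - 1) * k + snd x"

definition block_gens :: "nat \<Rightarrow> nat \<Rightarrow> nat \<Rightarrow> ((nat \<times> nat) \<times> (nat \<times> nat)) set" where
  "block_gens m s k =
     {((i, a), (i, a + 1)) | i a. (i, a) \<in> block_elems m s k \<and> (i, a + 1) \<in> block_elems m s k} \<union>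
     {((i + 1, 1), (i, k)) | i. 1 \<le> i \<and> i \<le> m}"

definition block_poset :: "nat \<Rightarrow> nat \<Rightarrow> nat \<Rightarrow> ((nat \<times> nat) \<times> (nat \<times> nat)) set" where
  "block_poset m s k = Id_on (block_elems m s k) \<union> (block_gens m s k)\<^sup>+"

definition P321 :: "nat \<Rightarrow> nat \<Rightarrow> nat \<Rightarrow> ((nat \<times> nat) \<times> (nat \<times> nat)) set" where
  "P321 m s k = (block_poset m s k \<union>
     {((i + 1, 1), y) | i y. 1 \<le> i \<and> i \<le> m \<and> y \<in> block_elems m s k \<and>
        block_pos k (i + 1, 1) < block_pos k y})\<^sup>+"

definition linear_extensions :: "'a set \<Rightarrow> 'a rel \<Rightarrow> 'a rel set" where
  "linear_extensions A r = {l. linear_order_on A l \<and> r \<subseteq> l}"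

definition LE :: "'a set \<Rightarrow> 'a rel \<Rightarrow> nat" where
  "LE A r = card (linear_extensions A r)"

end

theory Submission
  imports Defs
begin

text \<open>The Lehmer code of \<open>\<pi>\<close> records, for each position, the number of smaller later entries. Position
  \<open>i\<close> is a descent iff the code drops from \<open>i\<close> to \<open>i + 1\<close>, and, given whether \<open>i\<close> is a descent, avoiding a
  pattern at \<open>i\<close> is again a condition on the two code entries at \<open>i\<close> and \<open>i + 1\<close>: for instance an ascent
  starts no \<open>132\<close> iff the two entries agree, and a descent starts no \<open>312\<close> iff they differ by one. So
  every count is a transfer-matrix sum over codes. For \<open>132\<close> and \<open>312\<close> these sums obey the recursion of
  the Raney numbers \<open>z / (n k + z) \<cdot> (n k + z choose n)\<close>; for \<open>213\<close> and \<open>231\<close> they factor over the blocks.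
  For \<open>k = 2\<close> avoiding \<open>123\<close> and avoiding \<open>213\<close> are equivalent, and for \<open>321\<close> the conditions on \<open>\<pi>\<close> are
  literally the relations of the poset, read as inequalities between values.\<close>

section \<open>Raney numbers and their closed form\<close>

text \<open>A division-free form of the Raney numbers. With \<open>B = 1 + x B^k\<close> the value
  is the coefficient of \<open>x^n\<close> in \<open>B^z\<close>, and the last equation is
  \<open>B^(z+1) = B^z + x B^(z+k)\<close>.\<close>

fun raney :: "nat \<Rightarrow> nat \<Rightarrow> nat \<Rightarrow> nat" where
  "raney k 0 z = 1"
| "raney k (Suc n) 0 = 0"
| "raney k (Suc n) (Suc z) = raney k (Suc n) z + raney k n (z + k)"

text \<open>The recursion step of the closed form, where \<open>b\<close>, \<open>c\<close>,
  \<open>d\<close> stand for \<open>M choose n\<close>, \<open>M choose (n + 1)\<close>,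
  \<open>(M + 1) choose (n + 1)\<close>. Multiplied by \<open>a\<close>, both sides become
  \<open>(z + 1) * b\<close>.\<close>

lemma raney_step_real:
  fixes a b c d z M n k :: real
  assumes "a * c = (M - n) * b" "a * d = (M + 1) * b" "M = a * k + z" "a = n + 1" "a > 0" "M > 0"
  shows "z / M * c + (z + k) / M * b = (z + 1) / (M + 1) * d"
proof -
  have sum: "z / M * c + (z + k) / M * b = (z * c + (z + k) * b) / M" by (simp only: times_divide_eq_left add_divide_distrib[symmetric])
  have "a * (z * c + (z + k) * b) = z * (a * c) + (a * z + a * k) * b" by algebra
  also have "\<dots> = z * ((M - n) * b) + (a * z + (M - z)) * b" using assms by simp
  also have "\<dots> = M * (z + 1) * b" unfolding assms(4) by algebra
  finally have "a * ((z * c + (z + k) * b) / M) = (z + 1) * b"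
    using assms(6) by (simp only: times_divide_eq_right mult.assoc nonzero_mult_div_cancel_left)
  moreover have "a * ((z + 1) / (M + 1) * d) = (z + 1) / (M + 1) * (a * d)" by simp
  moreover have "\<dots> = (z + 1) * b" unfolding assms(2) using assms(6) by simp
  ultimately show ?thesis
    unfolding sum using assms(5) by (metis mult_cancel_left less_irrefl)
qed

text \<open>Both recursive calls lead to the same upper index \<open>M\<close>, so they combine
  through the absorption identities. The first hypothesis excludes \<open>n = z = 0\<close>, where
  the recursion gives 1 but the quotient evaluates to 0.\<close>

lemma raney_closed_form:
  assumes "n * k + z > 0" "k > 0"
  shows "real (raney k n z) = real z / real (n * k + z) * real ((n * k + z) choose n)"
  using assms
proof (induction k n z rule: raney.induct)
  case (1 k z)
  then show ?case by simp
next
  case (2 k n)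
  then show ?case by simp
next
  case (3 k n z)
  define M where "M = Suc n * k + z"
  have M: "M > 0" "n * k + (z + k) = M" "Suc n * k + Suc z = Suc M"
    using 3 by (auto simp: M_def)
  \<comment> \<open>Lets the truncated difference \<open>M - n\<close> below pass to the
    reals.\<close>
  have le: "Suc n \<le> M"
  proof -
    have "Suc n * 1 \<le> Suc n * k" using 3(4) by (intro mult_le_mono2) simp
    then show ?thesis unfolding M_def mult_1_right by (rule trans_le_add1)
  qed
  have IH1: "real (raney k (Suc n) z) = real z / real M * real (M choose Suc n)"
    using 3(1)[OF _ 3(4)] M(1) unfolding M_def by simp
  have IH2: "real (raney k n (z + k)) = real (z + k) / real M * real (M choose n)"
    using 3(2)[OF _ 3(4)] M(1,2) by simp
  have c1: "real (Suc n) * real (M choose Suc n) = (real M - real n) * real (M choose n)"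
  proof -
    have "Suc n * (M choose Suc n) = (M - n) * (M choose n)"
      by (simp only: binomial_absorption binomial_absorb_comp)
    then have "real (Suc n * (M choose Suc n)) = real ((M - n) * (M choose n))"
      by (rule arg_cong)
    then show ?thesis using le by (simp only: of_nat_mult of_nat_diff Suc_leD)
  qed
  have c2: "real (Suc n) * real (Suc M choose Suc n) = real (Suc M) * real (M choose n)"
    using arg_cong[OF Suc_times_binomial_eq[of M n], of real]
    by (simp only: of_nat_mult ac_simps)
  have "real (raney k (Suc n) (Suc z))
      = real z / real M * real (M choose Suc n) + (real z + real k) / real M * real (M choose n)"
    by (simp add: IH1 IH2)
  also have "\<dots> = (real z + 1) / (real M + 1) * real (Suc M choose Suc n)"
  proof (rule raney_step_real[OF c1])
    show "real (Suc n) * real (Suc M choose Suc n) = (real M + 1) * real (M choose n)"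
      unfolding c2 by (simp only: of_nat_Suc add.commute)
    show "real M = real (Suc n) * real k + real z"
      unfolding M_def by (simp only: of_nat_add of_nat_mult)
  qed (use M(1) in simp_all)
  finally show ?case unfolding M(3) by (simp only: of_nat_Suc add.commute)
qed

section \<open>Counting words through their Lehmer codes\<close>

text \<open>The two cardinalities are the code entries of the first two letters. Words over an
  arbitrary set of naturals allow an induction that deletes the first letter without renumbering the
  others.\<close>

fun admissible :: "(nat \<Rightarrow> nat \<Rightarrow> nat \<Rightarrow> bool) \<Rightarrow> nat \<Rightarrow> nat list \<Rightarrow> bool" where
  "admissible R p (x # y # zs) \<longleftrightarrow>
     R p (card {z \<in> set (y # zs). z < x}) (card {z \<in> set zs. z < y}) \<and> admissible R (Suc p) (y # zs)"
| "admissible R p _ \<longleftrightarrow> True"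

text \<open>The number of codes \<open>t\<^sub>0, \<dots>, t\<^sub>n\<close> with first entry \<open>t\<close>, in which \<open>t\<^sub>i\<close> belongs to position
  \<open>p + i\<close> and is at most \<open>n - i\<close>; meaningful only for \<open>t \<le> n\<close>.\<close>

fun codes :: "(nat \<Rightarrow> nat \<Rightarrow> nat \<Rightarrow> bool) \<Rightarrow> nat \<Rightarrow> nat \<Rightarrow> nat \<Rightarrow> nat" where
  "codes R p 0 t = 1"
| "codes R p (Suc n) t = (\<Sum>u\<le>n. if R p t u then codes R (Suc p) n u else 0)"

text \<open>The reason why codes are free: choosing the next letter among the remaining ones amounts
  to choosing its rank among them.\<close>

lemma bij_betw_rank:
  fixes A :: "nat set"
  assumes "finite A"
  shows "bij_betw (\<lambda>x. card {z \<in> A. z < x}) A {..<card A}"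
proof -
  let ?f = "\<lambda>x. card {z \<in> A. z < x}"
  have less: "?f x < ?f y" if "x \<in> A" "x < y" for x y
    using that assms by (intro psubset_card_mono) auto
  have "inj_on ?f A"
    by (metis (no_types, lifting) inj_onI less less_irrefl linorder_less_linear)
  moreover have "?f ` A \<subseteq> {..<card A}"
    using assms by (auto intro!: psubset_card_mono)
  ultimately show ?thesis
    by (simp add: bij_betw_def card_subset_eq card_image)
qed

text \<open>Split by the second letter \<open>y\<close> after deleting \<open>x\<close>. The first
  condition depends only on the ranks of \<open>x\<close> and \<open>y\<close>, and what remains is
  the same problem for \<open>A - {x}\<close>.\<close>

lemma card_admissible_hd:
  assumes "finite A" "card A = Suc n" "x \<in> A"
  shows "card {xs. distinct xs \<and> set xs = A \<and> hd xs = x \<and> admissible R p xs}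
       = codes R p n (card {z \<in> A. z < x})"
  using assms
proof (induction n arbitrary: A x p)
  case 0
  then have "A = {x}" by (metis card_1_singletonE One_nat_def singletonD)
  moreover have "{xs. distinct xs \<and> set xs = {x} \<and> hd xs = x \<and> admissible R p xs} = {[x]}"
  proof (intro equalityI subsetI)
    fix xs assume "xs \<in> {xs. distinct xs \<and> set xs = {x} \<and> hd xs = x \<and> admissible R p xs}"
    then have "distinct xs" "set xs = {x}" by auto
    then have "length xs = 1" using distinct_card[of xs] by simp
    then show "xs \<in> {[x]}" using \<open>set xs = {x}\<close> by (cases xs) auto
  qed auto
  ultimately show ?case by simp
next
  case (Suc n)
  let ?B = "A - {x}"
  let ?r = "\<lambda>y. card {z \<in> ?B - {y}. z < y}"
  let ?t = "card {z \<in> A. z < x}"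
  let ?L = "\<lambda>y. {ys. distinct ys \<and> set ys = ?B \<and> hd ys = y \<and> admissible R (Suc p) ys}"
  have B: "finite ?B" "card ?B = Suc n" using Suc.prems by auto
  \<comment> \<open>No letter is below itself, so the rank within a set containing the letter is
    also its code entry, which looks at later letters only.\<close>
  have tB: "?t = card {z \<in> ?B. z < x}"
    by (rule arg_cong[where f = card]) auto
  have r: "?r y = card {z \<in> ?B. z < y}" for y
    by (rule arg_cong[where f = card]) auto
  have fin: "finite (?L y)" for y
    by (rule finite_subset[OF _ finite_subset_distinct[OF B(1)]]) auto
  have eq: "{xs. distinct xs \<and> set xs = A \<and> hd xs = x \<and> admissible R p xs}
      = (\<Union>y \<in> {y \<in> ?B. R p ?t (?r y)}. (#) x ` ?L y)" (is "?S = ?U")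
  proof (intro equalityI subsetI)
    fix xs assume "xs \<in> ?S"
    then have xs: "distinct xs" "set xs = A" "hd xs = x" "admissible R p xs" by auto
    then obtain ys where ys: "xs = x # ys" using Suc.prems(3) by (cases xs) auto
    have d: "distinct ys" "set ys = ?B" using xs(1,2) unfolding ys by auto
    have "ys \<noteq> []" using d(2) B(2) by (metis card.empty list.set(1) nat.distinct(1))
    then obtain y zs where yz: "ys = y # zs" by (cases ys) auto
    have zs: "set zs = ?B - {y}" "y \<in> ?B" using d unfolding yz by auto
    have "R p ?t (?r y)" "admissible R (Suc p) ys"
      using xs(4) d(2) unfolding ys yz by (simp_all only: admissible.simps tB zs(1))
    then show "xs \<in> ?U" using d zs(2) ys yz by (intro UN_I[of y] imageI) simp_all
  next
    fix xs assume "xs \<in> ?U"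
    then obtain y where y: "y \<in> ?B" "R p ?t (?r y)" and "xs \<in> (#) x ` ?L y" by blast
    then obtain ys where "ys \<in> ?L y" and xs: "xs = x # ys" by blast
    then have ys: "distinct ys" "set ys = ?B" "hd ys = y" "admissible R (Suc p) ys" by auto
    have "ys \<noteq> []" using ys(2) y(1) by (metis emptyE list.set(1))
    then obtain zs where yz: "ys = y # zs" using ys(3) by (cases ys) auto
    have "set zs = ?B - {y}" using ys(1,2) unfolding yz by auto
    then have "admissible R p (x # y # zs)"
      using y ys(2,4) unfolding yz by (simp only: admissible.simps tB)
    moreover have "set (x # ys) = A" "distinct (x # ys)" using ys(1,2) Suc.prems(3) by auto
    ultimately show "xs \<in> ?S" unfolding xs yz by simp
  qed
  have "card ?S = (\<Sum>y \<in> {y \<in> ?B. R p ?t (?r y)}. card ((#) x ` ?L y))"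
    unfolding eq
  proof (rule card_UN_disjoint)
    show "\<forall>y\<in>{y \<in> ?B. R p ?t (?r y)}. \<forall>z\<in>{y \<in> ?B. R p ?t (?r y)}. y \<noteq> z \<longrightarrow>
        (#) x ` ?L y \<inter> (#) x ` ?L z = {}" by blast
  qed (use B(1) fin in simp_all)
  also have "\<dots> = (\<Sum>y \<in> {y \<in> ?B. R p ?t (?r y)}. codes R (Suc p) n (?r y))"
  proof (rule sum.cong[OF refl])
    fix y assume "y \<in> {y \<in> ?B. R p ?t (?r y)}"
    then have "card (?L y) = codes R (Suc p) n (?r y)"
      unfolding r by (intro Suc.IH B) simp
    moreover have "card ((#) x ` ?L y) = card (?L y)" by (rule card_image) simp
    ultimately show "card ((#) x ` ?L y) = codes R (Suc p) n (?r y)" by simp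
  qed
  also have "\<dots> = (\<Sum>y \<in> ?B. if R p ?t (?r y) then codes R (Suc p) n (?r y) else 0)"
    by (rule sum.inter_filter[OF B(1)])
  \<comment> \<open>Summing over the letters \<open>y\<close> turns into summing over their ranks
    \<open>u\<close>, the next code entries.\<close>
  also have "\<dots> = (\<Sum>u \<in> {..<card ?B}. if R p ?t u then codes R (Suc p) n u else 0)"
    unfolding r by (rule sum.reindex_bij_betw[OF bij_betw_rank[OF B(1)]])
  finally show ?case using B(2) by (simp add: lessThan_Suc_atMost)
qed

lemma card_admissible:
  assumes "finite A" "card A = Suc n"
  shows "card {xs. distinct xs \<and> set xs = A \<and> admissible R p xs} = (\<Sum>t\<le>n. codes R p n t)"
proof -
  let ?L = "\<lambda>x. {xs. distinct xs \<and> set xs = A \<and> hd xs = x \<and> admissible R p xs}"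
  have fin: "finite (?L y)" for y
    by (rule finite_subset[OF _ finite_subset_distinct[OF assms(1)]]) auto
  have "{xs. distinct xs \<and> set xs = A \<and> admissible R p xs} = (\<Union>x\<in>A. ?L x)"
    using assms(2) by (auto intro!: hd_in_set)
  also have "card \<dots> = (\<Sum>x\<in>A. card (?L x))"
    using assms(1) fin by (intro card_UN_disjoint) auto
  also have "\<dots> = (\<Sum>x\<in>A. codes R p n (card {z \<in> A. z < x}))"
    by (intro sum.cong refl card_admissible_hd assms)
  also have "\<dots> = (\<Sum>t<card A. codes R p n t)"
    by (rule sum.reindex_bij_betw[OF bij_betw_rank[OF assms(1)]])
  finally show ?thesis using assms(2) by (simp add: lessThan_Suc_atMost)
qed

section \<open>From words to permutations\<close>

definition lehmer :: "nat \<Rightarrow> (nat \<Rightarrow> nat) \<Rightarrow> nat \<Rightarrow> nat" where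
  "lehmer N \<pi> i = card {j \<in> {i<..N}. \<pi> j < \<pi> i}"

text \<open>Words count later values while \<open>lehmer\<close> counts later positions; injectivity
  of \<pi> identifies the two counts.\<close>

lemma admissible_map_upt:
  assumes "inj_on \<pi> {p..N}" "p \<le> N"
  shows "admissible R p (map \<pi> [p..<Suc N]) \<longleftrightarrow>
     (\<forall>i\<in>{p..<N}. R i (lehmer N \<pi> i) (lehmer N \<pi> (Suc i)))"
  using assms
proof (induction "N - p" arbitrary: p)
  case 0
  then show ?case by simp
next
  case (Suc d)
  have c: "card {z \<in> \<pi> ` {i<..N}. z < \<pi> i} = lehmer N \<pi> i" if "i \<ge> p" for i
  proof -
    have "{z \<in> \<pi> ` {i<..N}. z < \<pi> i} = \<pi> ` {j \<in> {i<..N}. \<pi> j < \<pi> i}" by auto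
    moreover have "inj_on \<pi> {j \<in> {i<..N}. \<pi> j < \<pi> i}"
      using Suc.prems(1) that by (auto intro: inj_on_subset)
    ultimately show ?thesis by (simp add: lehmer_def card_image)
  qed
  have IH: "admissible R (Suc p) (map \<pi> [Suc p..<Suc N]) \<longleftrightarrow>
     (\<forall>i\<in>{Suc p..<N}. R i (lehmer N \<pi> i) (lehmer N \<pi> (Suc i)))"
    using Suc by (intro Suc.hyps) (auto intro: inj_on_subset)
  have split: "[p..<Suc N] = p # [Suc p..<Suc N]" "[Suc p..<Suc N] = Suc p # [Suc (Suc p)..<Suc N]"
    using Suc by (auto simp: upt_conv_Cons simp del: upt_Suc)
  have sets: "set (\<pi> (Suc p) # map \<pi> [Suc (Suc p)..<Suc N]) = \<pi> ` {p<..N}"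
    "set (map \<pi> [Suc (Suc p)..<Suc N]) = \<pi> ` {Suc p<..N}"
  proof -
    have "{p<..N} = insert (Suc p) {Suc p<..N}" "{Suc (Suc p)..<Suc N} = {Suc p<..N}"
      using Suc by auto
    then show "set (\<pi> (Suc p) # map \<pi> [Suc (Suc p)..<Suc N]) = \<pi> ` {p<..N}"
      "set (map \<pi> [Suc (Suc p)..<Suc N]) = \<pi> ` {Suc p<..N}"
      by (simp_all del: upt_Suc)
  qed
  have "admissible R p (map \<pi> [p..<Suc N]) \<longleftrightarrow>
      R p (lehmer N \<pi> p) (lehmer N \<pi> (Suc p)) \<and> admissible R (Suc p) (map \<pi> [Suc p..<Suc N])"
    unfolding split list.map admissible.simps sets using c[of p] c[of "Suc p"] by simp
  moreover have "{p..<N} = insert p {Suc p..<N}" using Suc by auto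
  ultimately show ?case using IH by auto
qed

lemma bij_betw_map_permutes:
  "bij_betw (\<lambda>\<pi>. map \<pi> [1..<Suc N]) {\<pi>. \<pi> permutes {1..N}} {xs. distinct xs \<and> set xs = {1..N}}"
\<comment> \<open>The inverse fixes everything outside \<open>{1..N}\<close>, as
  \<open>permutes\<close> demands, and shifts the index because lists start at 0.\<close>
proof (rule bij_betw_byWitness[where f' = "\<lambda>xs i. if i \<in> {1..N} then xs ! (i - 1) else i"])
  show "\<forall>\<pi>\<in>{\<pi>. \<pi> permutes {1..N}}.
      (\<lambda>i. if i \<in> {1..N} then map \<pi> [1..<Suc N] ! (i - 1) else i) = \<pi>"
    by (auto simp: permutes_def fun_eq_iff simp del: upt_Suc)
  show "\<forall>xs\<in>{xs. distinct xs \<and> set xs = {1..N}}.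
      map (\<lambda>i. if i \<in> {1..N} then xs ! (i - 1) else i) [1..<Suc N] = xs"
  proof safe
    fix xs :: "nat list" assume "distinct xs" "set xs = {1..N}"
    then have "length xs = N" by (metis distinct_card card_atLeastAtMost diff_Suc_1)
    then show "map (\<lambda>i. if i \<in> {1..N} then xs ! (i - 1) else i) [1..<Suc N] = xs"
      by (auto intro!: nth_equalityI simp del: upt_Suc)
  qed
  show "(\<lambda>\<pi>. map \<pi> [1..<Suc N]) ` {\<pi>. \<pi> permutes {1..N}} \<subseteq> {xs. distinct xs \<and> set xs = {1..N}}"
  proof safe
    fix \<pi> assume "\<pi> permutes {1..N}"
    then have "inj_on \<pi> {1..N}" "\<pi> ` {1..N} = {1..N}"
      by (auto simp: permutes_inj_on permutes_image)
    moreover have "set [1..<Suc N] = {1..N}" by auto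
    ultimately show "distinct (map \<pi> [1..<Suc N])"
      and "\<And>x. x \<in> set (map \<pi> [1..<Suc N]) \<Longrightarrow> x \<in> {1..N}"
      and "\<And>x. x \<in> {1..N} \<Longrightarrow> x \<in> set (map \<pi> [1..<Suc N])"
      by (simp_all add: distinct_map del: upt_Suc)
  qed
  show "(\<lambda>xs i. if i \<in> {1..N} then xs ! (i - 1) else i) ` {xs. distinct xs \<and> set xs = {1..N}}
      \<subseteq> {\<pi>. \<pi> permutes {1..N}}"
  proof safe
    fix xs :: "nat list" assume xs: "distinct xs" "set xs = {1..N}"
    then have len: "length xs = N" by (metis distinct_card card_atLeastAtMost diff_Suc_1)
    let ?f = "\<lambda>i. if i \<in> {1..N} then xs ! (i - 1) else i"
    have "inj_on ?f {1..N}"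
    proof (rule inj_onI)
      fix i j assume "i \<in> {1..N}" "j \<in> {1..N}" "?f i = ?f j"
      then have "i - 1 = j - 1" using nth_eq_iff_index_eq[OF xs(1), of "i - 1" "j - 1"] len by auto
      then show "i = j" using \<open>i \<in> _\<close> \<open>j \<in> _\<close> by auto
    qed
    moreover have "?f ` {1..N} \<subseteq> {1..N}"
    proof safe
      fix i assume i: "i \<in> {1..N}"
      then have "xs ! (i - 1) \<in> set xs" using len by (intro nth_mem) auto
      then show "?f i \<in> {1..N}" using xs(2) i by simp
    qed
    ultimately have "bij_betw ?f {1..N} {1..N}"
      by (simp only: bij_betw_def endo_inj_surj finite_atLeastAtMost)
    then show "?f permutes {1..N}" by (rule bij_imp_permutes) auto
  qed
qed

text \<open>The master count: any property that is a conjunction of conditions on neighbouring code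
  entries is counted by \<open>codes\<close>.\<close>

lemma card_permutes_lehmer:
  "card {\<pi>. \<pi> permutes {1..Suc n} \<and>
      (\<forall>i\<in>{1..<Suc n}. R i (lehmer (Suc n) \<pi> i) (lehmer (Suc n) \<pi> (Suc i)))}
    = (\<Sum>t\<le>n. codes R 1 n t)" (is "card ?S = _")
proof -
  let ?g = "\<lambda>\<pi>. map \<pi> [1..<Suc (Suc n)]"
  let ?T = "{xs. distinct xs \<and> set xs = {1..Suc n} \<and> admissible R 1 xs}"
  have adm: "admissible R 1 (?g \<pi>) \<longleftrightarrow>
      (\<forall>i\<in>{1..<Suc n}. R i (lehmer (Suc n) \<pi> i) (lehmer (Suc n) \<pi> (Suc i)))"
    if "\<pi> permutes {1..Suc n}" for \<pi>
    using that by (intro admissible_map_upt) (auto simp: permutes_inj_on)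
  note b = bij_betw_map_permutes[of "Suc n"]
  have "?g ` ?S = ?T"
  proof (intro equalityI subsetI)
    fix xs assume "xs \<in> ?g ` ?S"
    then show "xs \<in> ?T" using adm bij_betwE[OF b] by (auto simp del: upt_Suc)
  next
    fix xs assume xs: "xs \<in> ?T"
    then have "xs \<in> ?g ` {\<pi>. \<pi> permutes {1..Suc n}}"
      using b by (auto simp: bij_betw_def simp del: upt_Suc)
    then show "xs \<in> ?g ` ?S" using adm xs by (auto simp del: upt_Suc)
  qed
  moreover have "inj_on ?g ?S"
    using b by (auto simp: bij_betw_def intro: inj_on_subset simp del: upt_Suc)
  ultimately have "card ?S = card ?T" using card_image[of ?g ?S] by (simp only:)
  then show ?thesis using card_admissible[of "{1..Suc n}" n R 1] by simp
qed

section \<open>Descents and patterns read off the code\<close>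

text \<open>Removing position \<open>i + 1\<close> makes the entries at \<open>i\<close> and
  \<open>i + 1\<close> comparable: both then count over the positions after \<open>i + 1\<close>,
  with thresholds \<open>\<pi> i\<close> and \<open>\<pi> (i + 1)\<close>.\<close>

lemma lehmer_split:
  assumes "i < N"
  shows "lehmer N \<pi> i = card {j \<in> {Suc i<..N}. \<pi> j < \<pi> i} + (if \<pi> (Suc i) < \<pi> i then 1 else 0)"
proof (cases "\<pi> (Suc i) < \<pi> i")
  case True
  have "{j \<in> {i<..N}. \<pi> j < \<pi> i} = insert (Suc i) {j \<in> {Suc i<..N}. \<pi> j < \<pi> i}"
    using assms True by (auto simp: Suc_lessI)
  then show ?thesis using True by (simp add: lehmer_def)
next
  case False
  have "{j \<in> {i<..N}. \<pi> j < \<pi> i} = {j \<in> {Suc i<..N}. \<pi> j < \<pi> i}"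
    using False by (auto simp: Suc_less_eq2 dest: Suc_lessI)
  then show ?thesis using False by (simp add: lehmer_def)
qed

text \<open>Counts grow with the threshold. At a descent the entry at \<open>i\<close> has the
  larger threshold and in addition counts \<open>i + 1\<close>, which makes the drop strict.\<close>

lemma lehmer_descent:
  assumes "i < N"
  shows "\<pi> (Suc i) < \<pi> i \<longleftrightarrow> lehmer N \<pi> (Suc i) < lehmer N \<pi> i"
proof (cases "\<pi> (Suc i) < \<pi> i")
  case True
  have "card {j \<in> {Suc i<..N}. \<pi> j < \<pi> (Suc i)} \<le> card {j \<in> {Suc i<..N}. \<pi> j < \<pi> i}"
    using True by (intro card_mono) auto
  then show ?thesis using True lehmer_split[OF assms, of \<pi>] by (simp add: lehmer_def)
next
  case False
  have "card {j \<in> {Suc i<..N}. \<pi> j < \<pi> i} \<le> card {j \<in> {Suc i<..N}. \<pi> j < \<pi> (Suc i)}"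
    using False by (intro card_mono) auto
  then show ?thesis using False lehmer_split[OF assms, of \<pi>] by (simp add: lehmer_def)
qed

lemma card_Collect_less_eq_iff:
  fixes a b :: nat
  assumes "finite J" "a \<le> b"
  shows "card {j \<in> J. \<pi> j < a} = card {j \<in> J. \<pi> j < b} \<longleftrightarrow> (\<forall>j\<in>J. \<not> (a \<le> \<pi> j \<and> \<pi> j < b))"
proof
  assume "card {j \<in> J. \<pi> j < a} = card {j \<in> J. \<pi> j < b}"
  then have "{j \<in> J. \<pi> j < a} = {j \<in> J. \<pi> j < b}"
    using assms by (intro card_subset_eq) auto
  then show "\<forall>j\<in>J. \<not> (a \<le> \<pi> j \<and> \<pi> j < b)" by force
next
  assume "\<forall>j\<in>J. \<not> (a \<le> \<pi> j \<and> \<pi> j < b)"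
  then have "{j \<in> J. \<pi> j < a} = {j \<in> J. \<pi> j < b}" using assms(2) by force
  then show "card {j \<in> J. \<pi> j < a} = card {j \<in> J. \<pi> j < b}" by simp
qed

context
  fixes \<pi> :: "nat \<Rightarrow> nat" and N i :: nat
  assumes inj: "inj_on \<pi> {1..N}" and i: "1 \<le> i" "i < N"
begin

text \<open>Turns the half-open gaps of \<open>card_Collect_less_eq_iff\<close> into the open ones
  that patterns ask for.\<close>

lemma later_neq: "j \<in> {Suc i<..N} \<Longrightarrow> \<pi> j \<noteq> \<pi> i" "j \<in> {Suc i<..N} \<Longrightarrow> \<pi> j \<noteq> \<pi> (Suc i)"
  using inj i by (auto dest: inj_onD)

text \<open>At an ascent the difference of the entries counts the later values strictly between the
  two letters, that is, the possible last letters of a 132.\<close>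

lemma lehmer_eq_Suc:
  assumes "\<pi> i < \<pi> (Suc i)"
  shows "lehmer N \<pi> i = lehmer N \<pi> (Suc i) \<longleftrightarrow> (\<forall>j\<in>{Suc i<..N}. \<not> (\<pi> i < \<pi> j \<and> \<pi> j < \<pi> (Suc i)))"
proof -
  have "lehmer N \<pi> i = lehmer N \<pi> (Suc i) \<longleftrightarrow>
      card {j \<in> {Suc i<..N}. \<pi> j < \<pi> i} = card {j \<in> {Suc i<..N}. \<pi> j < \<pi> (Suc i)}"
    unfolding lehmer_split[OF i(2)] lehmer_def[of N \<pi> "Suc i"] using assms by auto
  also have "\<dots> \<longleftrightarrow> (\<forall>j\<in>{Suc i<..N}. \<not> (\<pi> i \<le> \<pi> j \<and> \<pi> j < \<pi> (Suc i)))"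
    using assms by (intro card_Collect_less_eq_iff) auto
  also have "\<dots> \<longleftrightarrow> (\<forall>j\<in>{Suc i<..N}. \<not> (\<pi> i < \<pi> j \<and> \<pi> j < \<pi> (Suc i)))"
    using later_neq(1) by (intro ball_cong refl) (metis le_neq_implies_less less_imp_le)
  finally show ?thesis .
qed

text \<open>At an ascent position \<open>i + 1\<close> is not counted, so the entry counts exactly
  the possible last letters of a 231.\<close>

lemma lehmer_eq_0:
  assumes "\<pi> i < \<pi> (Suc i)"
  shows "lehmer N \<pi> i = 0 \<longleftrightarrow> (\<forall>j\<in>{Suc i<..N}. \<not> \<pi> j < \<pi> i)"
  using assms lehmer_split[OF i(2), of \<pi>] by auto

text \<open>The counterpart of \<open>lehmer_eq_Suc\<close> at a descent, for 312; the extra 1 is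
  position \<open>i + 1\<close> itself.\<close>

lemma lehmer_eq_Suc_lehmer_Suc:
  assumes "\<pi> (Suc i) < \<pi> i"
  shows "lehmer N \<pi> i = Suc (lehmer N \<pi> (Suc i)) \<longleftrightarrow>
    (\<forall>j\<in>{Suc i<..N}. \<not> (\<pi> (Suc i) < \<pi> j \<and> \<pi> j < \<pi> i))"
proof -
  have "lehmer N \<pi> i = Suc (lehmer N \<pi> (Suc i)) \<longleftrightarrow>
      card {j \<in> {Suc i<..N}. \<pi> j < \<pi> (Suc i)} = card {j \<in> {Suc i<..N}. \<pi> j < \<pi> i}"
    unfolding lehmer_split[OF i(2)] lehmer_def[of N \<pi> "Suc i"] using assms by auto
  also have "\<dots> \<longleftrightarrow> (\<forall>j\<in>{Suc i<..N}. \<not> (\<pi> (Suc i) \<le> \<pi> j \<and> \<pi> j < \<pi> i))"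
    using assms by (intro card_Collect_less_eq_iff) auto
  also have "\<dots> \<longleftrightarrow> (\<forall>j\<in>{Suc i<..N}. \<not> (\<pi> (Suc i) < \<pi> j \<and> \<pi> j < \<pi> i))"
    using later_neq(2) by (intro ball_cong refl) (metis le_neq_implies_less less_imp_le)
  finally show ?thesis .
qed

text \<open>There are \<open>N - i\<close> later positions, so the entry falls short of this by the
  number of later larger letters, the possible last letters of a 213.\<close>

lemma lehmer_eq_diff:
  assumes "\<pi> (Suc i) < \<pi> i"
  shows "lehmer N \<pi> i = N - i \<longleftrightarrow> (\<forall>j\<in>{Suc i<..N}. \<not> \<pi> i < \<pi> j)"
proof -
  have "lehmer N \<pi> i = N - i \<longleftrightarrow> card {j \<in> {Suc i<..N}. \<pi> j < \<pi> i} = card {Suc i<..N}"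
    using lehmer_split[OF i(2), of \<pi>] assms i by auto
  also have "\<dots> \<longleftrightarrow> {j \<in> {Suc i<..N}. \<pi> j < \<pi> i} = {Suc i<..N}"
    by (metis (no_types, lifting) card_subset_eq finite_greaterThanAtMost mem_Collect_eq subsetI)
  also have "\<dots> \<longleftrightarrow> (\<forall>j\<in>{Suc i<..N}. \<not> \<pi> i < \<pi> j)"
    using later_neq(1) by (auto simp: set_eq_iff not_less le_less)
  finally show ?thesis .
qed

end

section \<open>Transfer conditions for the avoidance classes\<close>

lemma Des_eq_multiples_iff:
  assumes "k > 0"
  shows "Des N \<pi> = (\<lambda>j. k * j) ` {1..(N - 1) div k} \<longleftrightarrow>
    (\<forall>i\<in>{1..<N}. \<pi> (Suc i) < \<pi> i \<longleftrightarrow> k dvd i)"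
proof -
  have le: "j \<le> (N - 1) div k \<longleftrightarrow> k * j \<le> N - 1" for j
    using assms by (simp add: less_eq_div_iff_mult_less_eq mult.commute)
  have "i \<in> (\<lambda>j. k * j) ` {1..(N - 1) div k} \<longleftrightarrow> 1 \<le> i \<and> i < N \<and> k dvd i" for i
  proof
    assume "i \<in> (\<lambda>j. k * j) ` {1..(N - 1) div k}"
    then obtain j where "i = k * j" "j \<in> {1..(N - 1) div k}" by (rule imageE)
    then have j: "i = k * j" "1 \<le> j" "k * j \<le> N - 1" by (simp_all only: atLeastAtMost_iff le)
    have "k * j > 0" using j(2) assms by simp
    then have "1 \<le> i" "i < N" using j(1,3) by linarith+
    then show "1 \<le> i \<and> i < N \<and> k dvd i" using j(1) by simp
  next
    assume i: "1 \<le> i \<and> i < N \<and> k dvd i"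
    then obtain j where j: "i = k * j" by (auto elim: dvdE)
    have "k * j \<le> N - 1" using i unfolding j by linarith
    moreover have "1 \<le> j" using i unfolding j by (cases j) simp_all
    ultimately have "1 \<le> j" "k * j \<le> N - 1" by blast+
    then show "i \<in> (\<lambda>j. k * j) ` {1..(N - 1) div k}"
      unfolding j by (intro imageI) (simp only: atLeastAtMost_iff le simp_thms)
  qed
  then have "(\<lambda>j. k * j) ` {1..(N - 1) div k} = {i \<in> {1..<N}. k dvd i}" by auto
  moreover have "Des N \<pi> = {i \<in> {1..<N}. \<pi> (Suc i) < \<pi> i}" unfolding Des_def by auto
  ultimately show ?thesis by (simp only: set_eq_iff mem_Collect_eq) blast
qed

text \<open>Descent set and avoidance become one condition at each position \<open>i\<close>, the
  shape that \<open>card_permutes_lehmer\<close> can count.\<close>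

lemma D_avoiding_iff:
  assumes "k > 0"
  shows "\<pi> \<in> D_avoiding N k pat \<longleftrightarrow> \<pi> permutes {1..N} \<and>
    (\<forall>i\<in>{1..<N}. (\<pi> (Suc i) < \<pi> i \<longleftrightarrow> k dvd i) \<and>
       (\<forall>j\<in>{Suc i<..N}. \<not> same_relative_order [\<pi> i, \<pi> (Suc i), \<pi> j] pat))"
proof -
  have "\<not> contains_vincular N \<pi> pat \<longleftrightarrow>
    (\<forall>i\<in>{1..<N}. \<forall>j\<in>{Suc i<..N}. \<not> same_relative_order [\<pi> i, \<pi> (Suc i), \<pi> j] pat)"
    unfolding contains_vincular_def by fastforce
  then show ?thesis
    unfolding D_avoiding_def D_def using Des_eq_multiples_iff[OF assms] by auto
qed

lemma card_D_avoiding_codes: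
  assumes "k > 0" "N > 0"
    and "\<And>\<pi> i. inj_on \<pi> {1..N} \<Longrightarrow> 1 \<le> i \<Longrightarrow> i < N \<Longrightarrow>
      ((\<pi> (Suc i) < \<pi> i \<longleftrightarrow> k dvd i) \<and>
         (\<forall>j\<in>{Suc i<..N}. \<not> same_relative_order [\<pi> i, \<pi> (Suc i), \<pi> j] pat)) \<longleftrightarrow>
      R i (lehmer N \<pi> i) (lehmer N \<pi> (Suc i))"
  shows "card (D_avoiding N k pat) = (\<Sum>t\<le>N - 1. codes R 1 (N - 1) t)"
proof -
  have "D_avoiding N k pat = {\<pi>. \<pi> permutes {1..N} \<and>
      (\<forall>i\<in>{1..<N}. R i (lehmer N \<pi> i) (lehmer N \<pi> (Suc i)))}"
  proof (intro set_eqI, unfold D_avoiding_iff[OF assms(1)] mem_Collect_eq, intro conj_cong ball_cong refl)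
    fix \<pi> i assume "\<pi> permutes {1..N}" "i \<in> {1..<N}"
    then show "((\<pi> (Suc i) < \<pi> i \<longleftrightarrow> k dvd i) \<and>
         (\<forall>j\<in>{Suc i<..N}. \<not> same_relative_order [\<pi> i, \<pi> (Suc i), \<pi> j] pat)) \<longleftrightarrow>
      R i (lehmer N \<pi> i) (lehmer N \<pi> (Suc i))"
      by (intro assms(3) permutes_inj_on) auto
  qed
  then show ?thesis using card_permutes_lehmer[of "N - 1" R] assms(2) by simp
qed

lemma same_relative_order_patterns:
  "same_relative_order [a, b, c] [1, 2, 3] \<longleftrightarrow> a < b \<and> b < c"
  "same_relative_order [a, b, c] [1, 3, 2] \<longleftrightarrow> a < c \<and> c < b"
  "same_relative_order [a, b, c] [2, 1, 3] \<longleftrightarrow> b < a \<and> a < c"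
  "same_relative_order [a, b, c] [2, 3, 1] \<longleftrightarrow> c < a \<and> a < b"
  "same_relative_order [a, b, c] [3, 1, 2] \<longleftrightarrow> b < c \<and> c < a"
  "same_relative_order [a, b, c] [3, 2, 1] \<longleftrightarrow> c < b \<and> b < a"
  unfolding same_relative_order_def by (auto simp: All_less_Suc)

text \<open>132 begins with an ascent, so multiples of \<open>k\<close> carry only the descent
  condition; elsewhere \<open>t = u\<close> expresses both the ascent and the avoidance.\<close>

lemma card_D_avoiding_132_codes:
  assumes "k > 0" "N > 0"
  shows "card (D_avoiding N k [1, 3, 2])
    = (\<Sum>t\<le>N - 1. codes (\<lambda>p t u. if k dvd p then u < t else t = u) 1 (N - 1) t)"
proof (rule card_D_avoiding_codes[OF assms])
  fix \<pi> :: "nat \<Rightarrow> nat" and i assume "inj_on \<pi> {1..N}" "1 \<le> i" "i < N"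
  note facts = lehmer_descent[OF \<open>i < N\<close>, of \<pi>] lehmer_eq_Suc[OF this]
  have "\<pi> i \<noteq> \<pi> (Suc i)" using \<open>inj_on \<pi> {1..N}\<close> \<open>1 \<le> i\<close> \<open>i < N\<close> by (auto dest: inj_onD)
  then show "((\<pi> (Suc i) < \<pi> i \<longleftrightarrow> k dvd i) \<and>
      (\<forall>j\<in>{Suc i<..N}. \<not> same_relative_order [\<pi> i, \<pi> (Suc i), \<pi> j] [1, 3, 2])) \<longleftrightarrow>
      (if k dvd i then lehmer N \<pi> (Suc i) < lehmer N \<pi> i else lehmer N \<pi> i = lehmer N \<pi> (Suc i))"
    unfolding same_relative_order_patterns using facts
    by (cases "\<pi> (Suc i) < \<pi> i") auto
qed

text \<open>213 begins with a descent, so its avoidance restricts only the multiples of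
  \<open>k\<close>, where it forces the largest possible entry.\<close>

lemma card_D_avoiding_213_codes:
  assumes "k > 0" "N > 0"
  shows "card (D_avoiding N k [2, 1, 3])
    = (\<Sum>t\<le>N - 1. codes (\<lambda>p t u. if k dvd p then u < t \<and> t = N - p else t \<le> u) 1 (N - 1) t)"
proof (rule card_D_avoiding_codes[OF assms])
  fix \<pi> :: "nat \<Rightarrow> nat" and i assume "inj_on \<pi> {1..N}" "1 \<le> i" "i < N"
  note facts = lehmer_descent[OF \<open>i < N\<close>, of \<pi>] lehmer_eq_diff[OF this]
  show "((\<pi> (Suc i) < \<pi> i \<longleftrightarrow> k dvd i) \<and>
      (\<forall>j\<in>{Suc i<..N}. \<not> same_relative_order [\<pi> i, \<pi> (Suc i), \<pi> j] [2, 1, 3])) \<longleftrightarrow>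
      (if k dvd i then lehmer N \<pi> (Suc i) < lehmer N \<pi> i \<and> lehmer N \<pi> i = N - i
       else lehmer N \<pi> i \<le> lehmer N \<pi> (Suc i))"
    unfolding same_relative_order_patterns using facts
    by (cases "\<pi> (Suc i) < \<pi> i") auto
qed

text \<open>As for 132, with \<open>t = 0\<close> now expressing both the ascent and the
  avoidance.\<close>

lemma card_D_avoiding_231_codes:
  assumes "k > 0" "N > 0"
  shows "card (D_avoiding N k [2, 3, 1])
    = (\<Sum>t\<le>N - 1. codes (\<lambda>p t u. if k dvd p then u < t else t = 0) 1 (N - 1) t)"
proof (rule card_D_avoiding_codes[OF assms])
  fix \<pi> :: "nat \<Rightarrow> nat" and i assume "inj_on \<pi> {1..N}" "1 \<le> i" "i < N"
  note facts = lehmer_descent[OF \<open>i < N\<close>, of \<pi>] lehmer_eq_0[OF this]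
  have "\<pi> i \<noteq> \<pi> (Suc i)" using \<open>inj_on \<pi> {1..N}\<close> \<open>1 \<le> i\<close> \<open>i < N\<close> by (auto dest: inj_onD)
  then show "((\<pi> (Suc i) < \<pi> i \<longleftrightarrow> k dvd i) \<and>
      (\<forall>j\<in>{Suc i<..N}. \<not> same_relative_order [\<pi> i, \<pi> (Suc i), \<pi> j] [2, 3, 1])) \<longleftrightarrow>
      (if k dvd i then lehmer N \<pi> (Suc i) < lehmer N \<pi> i else lehmer N \<pi> i = 0)"
    unfolding same_relative_order_patterns using facts
    by (cases "\<pi> (Suc i) < \<pi> i") auto
qed

text \<open>As for 213, with \<open>t = Suc u\<close> expressing both the descent and the
  avoidance.\<close>

lemma card_D_avoiding_312_codes:
  assumes "k > 0" "N > 0"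
  shows "card (D_avoiding N k [3, 1, 2])
    = (\<Sum>t\<le>N - 1. codes (\<lambda>p t u. if k dvd p then t = Suc u else t \<le> u) 1 (N - 1) t)"
proof (rule card_D_avoiding_codes[OF assms])
  fix \<pi> :: "nat \<Rightarrow> nat" and i assume "inj_on \<pi> {1..N}" "1 \<le> i" "i < N"
  note facts = lehmer_descent[OF \<open>i < N\<close>, of \<pi>] lehmer_eq_Suc_lehmer_Suc[OF this]
  show "((\<pi> (Suc i) < \<pi> i \<longleftrightarrow> k dvd i) \<and>
      (\<forall>j\<in>{Suc i<..N}. \<not> same_relative_order [\<pi> i, \<pi> (Suc i), \<pi> j] [3, 1, 2])) \<longleftrightarrow>
      (if k dvd i then lehmer N \<pi> i = Suc (lehmer N \<pi> (Suc i)) else lehmer N \<pi> i \<le> lehmer N \<pi> (Suc i))"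
    unfolding same_relative_order_patterns using facts
    by (cases "\<pi> (Suc i) < \<pi> i") auto
qed

section \<open>The pattern 231\<close>

text \<open>\<open>1 \<le> s\<close> puts \<open>m * k\<close> inside the range and
  \<open>s \<le> k\<close> keeps \<open>(m + 1) * k\<close> out of it.\<close>

lemma prod_multiples:
  fixes g :: "nat \<Rightarrow> nat"
  assumes "k > 0" "1 \<le> s" "s \<le> k"
  shows "(\<Prod>j\<in>{1..<m * k + s}. if k dvd j then g j else 1) = (\<Prod>j=1..m. g (j * k))"
proof -
  have eq: "{j \<in> {1..<m * k + s}. k dvd j} = (\<lambda>j. j * k) ` {1..m}"
  proof (intro equalityI subsetI)
    fix i assume "i \<in> {j \<in> {1..<m * k + s}. k dvd j}"
    then have i: "1 \<le> i" "i < m * k + s" "k dvd i" by auto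
    then obtain j where j: "i = j * k" by (metis dvd_div_mult_self)
    have "j * k < Suc m * k" using i(2) assms(3) unfolding j by simp
    then have "j < Suc m" using mult_less_cancel2 by blast
    moreover have "j \<noteq> 0" using i(1) j by auto
    ultimately show "i \<in> (\<lambda>j. j * k) ` {1..m}" unfolding j by auto
  next
    fix i assume "i \<in> (\<lambda>j. j * k) ` {1..m}"
    then obtain j where j: "i = j * k" "j \<in> {1..m}" by (rule imageE)
    have "j * k \<le> m * k" "j * k > 0" using j(2) assms(1) by auto
    then have "1 \<le> i" "i < m * k + s" "k dvd i" unfolding j(1) using assms(2) by (linarith, linarith, simp)
    then show "i \<in> {j \<in> {1..<m * k + s}. k dvd j}" by simp
  qed
  have "(\<Prod>j\<in>{1..<m * k + s}. if k dvd j then g j else 1) = prod g {j \<in> {1..<m * k + s}. k dvd j}"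
    by (rule prod.inter_filter[symmetric]) simp
  also have "\<dots> = (\<Prod>j=1..m. g (j * k))"
    unfolding eq using assms(1) by (subst prod.reindex) (auto simp: inj_on_def)
  finally show ?thesis .
qed

text \<open>Away from multiples of \<open>k\<close> the entry is forced to be 0. At a multiple
  \<open>p\<close> the next entry is 0, so any of the \<open>N - p\<close> positive entries may
  stand at \<open>p\<close>.\<close>

lemma sum_codes_231:
  assumes "k \<ge> 2" "p + n = N"
  shows "(\<Sum>t\<le>n. codes (\<lambda>p t u. if k dvd p then u < t else t = 0) p n t)
    = (\<Prod>j\<in>{p..<N}. if k dvd j then N - j else 1)"
  using assms(2)
proof (induction n arbitrary: p)
  case 0
  then show ?case by simp
next
  case (Suc n)
  let ?R = "\<lambda>p t u. if k dvd p then u < t else t = (0::nat)"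
  have IH: "(\<Sum>t\<le>n. codes ?R (Suc p) n t) = (\<Prod>j\<in>{Suc p..<N}. if k dvd j then N - j else 1)"
    using Suc by simp
  have split: "(\<Prod>j\<in>{p..<N}. if k dvd j then N - j else 1)
      = (if k dvd p then N - p else 1) * (\<Prod>j\<in>{Suc p..<N}. if k dvd j then N - j else 1)"
    using Suc.prems by (intro prod.atLeast_Suc_lessThan) simp
  show ?case
  proof (cases "k dvd p")
    case False
    have "(\<Sum>t\<le>Suc n. codes ?R p (Suc n) t) = (\<Sum>t\<le>Suc n. if t = 0 then \<Sum>u\<le>n. codes ?R (Suc p) n u else 0)"
      using False by (intro sum.cong) simp_all
    also have "\<dots> = (\<Sum>u\<le>n. codes ?R (Suc p) n u)" by (simp only: sum.delta finite_atMost) simp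
    finally show ?thesis unfolding split IH using False by simp
  next
    case True
    \<comment> \<open>As \<open>k \<ge> 2\<close>, position \<open>p + 1\<close> is no multiple of
      \<open>k\<close>, so its entry is 0. If it is the last position, \<open>codes\<close> is
      constantly 1 and the bound \<open>u \<le> n\<close> gives \<open>u = 0\<close>.\<close>
    have later: "codes ?R (Suc p) n u = (if u = 0 then codes ?R (Suc p) n 0 else 0)" if "u \<le> n" for u
    proof (cases n)
      case (Suc n')
      have "\<not> k dvd Suc p"
        using True assms(1) dvd_add_right_iff[of k p 1] by auto
      then show ?thesis unfolding Suc by simp
    qed (use that in simp)
    have tot: "(\<Sum>u\<le>n. codes ?R (Suc p) n u) = codes ?R (Suc p) n 0"
    proof -
      have "(\<Sum>u\<le>n. codes ?R (Suc p) n u) = (\<Sum>u\<le>n. if u = 0 then codes ?R (Suc p) n 0 else 0)"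
        by (intro sum.cong later refl) simp
      then show ?thesis by simp
    qed
    have each: "codes ?R p (Suc n) t = (if t = 0 then 0 else codes ?R (Suc p) n 0)" for t
    proof -
      have "codes ?R p (Suc n) t = (\<Sum>u\<le>n. if u < t then codes ?R (Suc p) n u else 0)"
        using True by (simp only: codes.simps if_True)
      also have "\<dots> = (\<Sum>u\<le>n. if u = 0 then (if 0 < t then codes ?R (Suc p) n 0 else 0) else 0)"
        by (intro sum.cong refl) (subst later, simp_all)
      finally show ?thesis by simp
    qed
    have "(\<Sum>t\<le>Suc n. codes ?R p (Suc n) t) = Suc n * codes ?R (Suc p) n 0"
      unfolding each sum.atMost_Suc_shift by simp
    moreover have "N - p = Suc n" using Suc.prems by simp
    ultimately show ?thesis unfolding split IH[symmetric] tot using True by (simp only: if_True)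
  qed
qed

lemma card_D_avoiding_231:
  assumes "k \<ge> 2" "1 \<le> s" "s \<le> k"
  shows "card (D_avoiding (m * k + s) k [2, 3, 1]) = (\<Prod>j < m. s + j * k)"
proof -
  let ?N = "m * k + s"
  have "card (D_avoiding ?N k [2, 3, 1]) = (\<Prod>j=1..m. ?N - j * k)"
  proof -
    have "card (D_avoiding ?N k [2, 3, 1])
        = (\<Sum>t\<le>?N - 1. codes (\<lambda>p t u. if k dvd p then u < t else t = 0) 1 (?N - 1) t)"
      using assms by (intro card_D_avoiding_231_codes) auto
    also have "\<dots> = (\<Prod>j\<in>{1..<?N}. if k dvd j then ?N - j else 1)"
      using assms by (intro sum_codes_231) auto
    finally show ?thesis using assms by (simp only: prod_multiples)
  qed
  also have "\<dots> = (\<Prod>j<m. s + j * k)"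
    by (rule prod.reindex_bij_witness[of _ "\<lambda>j. m - j" "\<lambda>j. m - j"])
       (auto simp: diff_mult_distrib)
  finally show ?thesis .
qed

section \<open>The pattern 132\<close>

text \<open>Telescoping: each summand is the difference of \<open>raney k (Suc n)\<close> at
  \<open>L - t + 1\<close> and \<open>L - t\<close>, and the sum starts from the value 0 at
  0.\<close>

lemma sum_raney:
  assumes "u \<le> L"
  shows "(\<Sum>t\<in>{u<..L}. raney k n (L + k - t)) = raney k (Suc n) (L - u)"
  using assms
proof (induction "L - u" arbitrary: u)
  case 0
  then show ?case by simp
next
  case (Suc d)
  have "{u<..L} = insert (Suc u) {Suc u<..L}" using Suc.hyps(2) by auto
  then have "(\<Sum>t\<in>{u<..L}. raney k n (L + k - t))
      = raney k n (L + k - Suc u) + (\<Sum>t\<in>{Suc u<..L}. raney k n (L + k - t))" by simp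
  also have "\<dots> = raney k n (d + k) + raney k (Suc n) d"
  proof -
    have e: "L + k - Suc u = d + k" "L - Suc u = d" "Suc u \<le> L"
      using Suc.hyps(2) by linarith+
    have "(\<Sum>t\<in>{Suc u<..L}. raney k n (L + k - t)) = raney k (Suc n) (L - Suc u)"
      by (rule Suc.hyps(1)[OF e(2)[symmetric] e(3)])
    then show ?thesis by (simp only: e)
  qed
  also have "\<dots> = raney k (Suc n) (L - u)" using Suc.hyps(2)[symmetric] by simp
  finally show ?case .
qed

text \<open>The counts of codes by first entry are only piecewise polynomial, so the recursion is run on its
  adjoint: each first entry is weighted by the number of ways to prepend an admissible beginning.\<close>

lemma sum_codes_132_step:
  fixes \<phi> :: "nat \<Rightarrow> nat"
  shows "(\<Sum>t\<le>Suc n. codes (\<lambda>p t u. if k dvd p then u < t else t = u) p (Suc n) t * \<phi> t)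
    = (\<Sum>u\<le>n. codes (\<lambda>p t u. if k dvd p then u < t else t = u) (Suc p) n u *
         (if k dvd p then \<Sum>t\<in>{u<..Suc n}. \<phi> t else \<phi> u))" (is "?l = ?r")
proof -
  let ?R = "\<lambda>p t u. if k dvd p then u < t else t = (u::nat)"
  have "?l = (\<Sum>t\<le>Suc n. \<Sum>u\<le>n. if ?R p t u then codes ?R (Suc p) n u * \<phi> t else 0)"
    by (simp only: codes.simps sum_distrib_right) (intro sum.cong refl, simp)
  also have "\<dots> = (\<Sum>u\<le>n. \<Sum>t\<le>Suc n. if ?R p t u then codes ?R (Suc p) n u * \<phi> t else 0)"
    by (rule sum.swap)
  also have "\<dots> = ?r"
  proof (rule sum.cong[OF refl])
    fix u assume u: "u \<in> {..n}"
    have "(\<Sum>t\<le>Suc n. if ?R p t u then codes ?R (Suc p) n u * \<phi> t else 0)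
        = codes ?R (Suc p) n u * (\<Sum>t\<le>Suc n. if ?R p t u then \<phi> t else 0)"
      unfolding sum_distrib_left by (intro sum.cong refl) simp
    also have "(\<Sum>t\<le>Suc n. if ?R p t u then \<phi> t else 0) = sum \<phi> {t \<in> {..Suc n}. ?R p t u}"
      by (rule sum.inter_filter[symmetric]) simp
    also have "{t \<in> {..Suc n}. ?R p t u} = (if k dvd p then {u<..Suc n} else {u})"
      using u by auto
    finally show "(\<Sum>t\<le>Suc n. if ?R p t u then codes ?R (Suc p) n u * \<phi> t else 0)
        = codes ?R (Suc p) n u * (if k dvd p then \<Sum>t\<in>{u<..Suc n}. \<phi> t else \<phi> u)"
      by (cases "k dvd p") simp_all
  qed
  finally show ?thesis .
qed

text \<open>The weighted sum does not depend on \<open>p\<close>, and the right side is its value at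
  \<open>p = N\<close>. Here \<open>(p - 1) div k\<close> is the number of prescribed descents
  before \<open>p\<close>.\<close>

lemma sum_codes_132:
  assumes "k > 0" "p > 0" "p + n = N"
  shows "(\<Sum>t\<le>n. codes (\<lambda>p t u. if k dvd p then u < t else t = u) p n t *
      raney k ((p - 1) div k) (N - (p - 1) div k * k - t)) = raney k ((N - 1) div k) (N - (N - 1) div k * k)"
  using assms(2,3)
proof (induction n arbitrary: p)
  case 0
  then show ?case by simp
next
  case (Suc n)
  let ?q = "(p - 1) div k"
  have step: "(if k dvd p then \<Sum>t\<in>{u<..Suc n}. raney k ?q (N - ?q * k - t) else raney k ?q (N - ?q * k - u))
      = raney k ((Suc p - 1) div k) (N - (Suc p - 1) div k * k - u)" if "u \<le> n" for u
  proof (cases "k dvd p")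
    case True
    then obtain j where j: "p = k * j" by blast
    then obtain i where i: "j = Suc i" using Suc.prems(1) by (cases j) auto
    have q: "?q = i" unfolding j i using assms(1) by (intro div_nat_eqI) auto
    \<comment> \<open>With \<open>p = Suc i * k\<close> the remaining length is
      \<open>Suc n\<close>, so \<open>sum_raney\<close> applies with
      \<open>L = Suc n\<close>.\<close>
    have w: "N - i * k = Suc n + k" "N - Suc i * k = Suc n" "p div k = Suc i"
      using Suc.prems(2) j i assms(1) by (auto simp: mult.commute)
    have "u \<le> Suc n" using that by simp
    from sum_raney[OF this, of k i] show ?thesis
      unfolding q diff_Suc_1 w using True by (simp only: if_True)
  next
    case False
    then have "p div k = ?q"
      using Suc.prems(1) div_Suc[of "p - 1" k] by (simp add: dvd_eq_mod_eq_0)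
    then show ?thesis using False by simp
  qed
  have "(\<Sum>t\<le>Suc n. codes (\<lambda>p t u. if k dvd p then u < t else t = u) p (Suc n) t * raney k ?q (N - ?q * k - t))
    = (\<Sum>u\<le>n. codes (\<lambda>p t u. if k dvd p then u < t else t = u) (Suc p) n u *
        (if k dvd p then \<Sum>t\<in>{u<..Suc n}. raney k ?q (N - ?q * k - t) else raney k ?q (N - ?q * k - u)))"
    by (rule sum_codes_132_step)
  also have "\<dots> = (\<Sum>u\<le>n. codes (\<lambda>p t u. if k dvd p then u < t else t = u) (Suc p) n u *
        raney k ((Suc p - 1) div k) (N - (Suc p - 1) div k * k - u))"
  proof (rule sum.cong[OF refl])
    fix u assume "u \<in> {..n}"
    then have "u \<le> n" unfolding atMost_iff .
    from step[OF this]
    show "codes (\<lambda>p t u. if k dvd p then u < t else t = u) (Suc p) n u *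
        (if k dvd p then \<Sum>t\<in>{u<..Suc n}. raney k ?q (N - ?q * k - t) else raney k ?q (N - ?q * k - u))
      = codes (\<lambda>p t u. if k dvd p then u < t else t = u) (Suc p) n u *
        raney k ((Suc p - 1) div k) (N - (Suc p - 1) div k * k - u)"
      by (rule arg_cong)
  qed
  also have "\<dots> = raney k ((N - 1) div k) (N - (N - 1) div k * k)"
    using Suc by (intro Suc.IH) simp_all
  finally show ?case .
qed

lemma div_last_block:
  fixes k m s :: nat
  assumes "1 \<le> s" "s \<le> k"
  shows "(m * k + s - 1) div k = m"
  by (rule div_nat_eqI) (use assms in \<open>auto simp: mult.commute\<close>)

lemma card_D_avoiding_132:
  assumes "k \<ge> 2" "1 \<le> s" "s \<le> k"
  shows "card (D_avoiding (m * k + s) k [1, 3, 2]) = raney k m s"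
proof -
  let ?N = "m * k + s"
  let ?R = "\<lambda>p t u. if k dvd p then u < t else t = (u::nat)"
  have q: "(?N - 1) div k = m" using assms(2,3) by (rule div_last_block)
  have "card (D_avoiding ?N k [1, 3, 2]) = (\<Sum>t\<le>?N - 1. codes ?R 1 (?N - 1) t)"
    using assms by (intro card_D_avoiding_132_codes) auto
  \<comment> \<open>At \<open>p = 1\<close> no descent lies before, and every weight is
    \<open>raney k 0 _ = 1\<close>.\<close>
  also have "\<dots> = (\<Sum>t\<le>?N - 1. codes ?R 1 (?N - 1) t * raney k ((1 - 1) div k) (?N - (1 - 1) div k * k - t))"
    by (intro sum.cong refl) simp
  also have "\<dots> = raney k ((?N - 1) div k) (?N - (?N - 1) div k * k)"
    using assms by (intro sum_codes_132) auto
  finally show ?thesis unfolding q by simp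
qed


section \<open>The pattern 312\<close>

text \<open>Unrolls the recursion along its second summand: raising \<open>t\<close> by one lowers
  the first index by one and, by \<open>arg\<close>, adds exactly \<open>k\<close> to what precedes
  the last unit of the second.\<close>

lemma sum_raney_diagonal:
  assumes "t \<le> v" "k > 0"
  shows "(\<Sum>u\<in>{t..v}. raney k (v - u) (a + (k - 1) * u)) = raney k (v - t) (Suc a + (k - 1) * t)"
  using assms(1)
proof (induction "v - t" arbitrary: t)
  case 0
  then have "t = v" by simp
  then show ?case by simp
next
  case (Suc d)
  have e: "d = v - Suc t" "Suc t \<le> v" using Suc.hyps(2) by linarith+
  have arg: "Suc a + (k - 1) * Suc t = a + (k - 1) * t + k"
    using assms(2) by (cases k) simp_all
  have "{t..v} = insert t {Suc t..v}" using Suc.prems by auto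
  then have "(\<Sum>u\<in>{t..v}. raney k (v - u) (a + (k - 1) * u))
      = raney k (v - t) (a + (k - 1) * t) + (\<Sum>u\<in>{Suc t..v}. raney k (v - u) (a + (k - 1) * u))" by simp
  also have "\<dots> = raney k (Suc d) (a + (k - 1) * t) + raney k d (a + (k - 1) * t + k)"
    unfolding Suc.hyps(1)[OF e] Suc.hyps(2)[symmetric] e(1)[symmetric] arg ..
  also have "\<dots> = raney k (v - t) (Suc a + (k - 1) * t)"
    unfolding Suc.hyps(2)[symmetric] by simp
  finally show ?case .
qed

lemma sum_if_le_and_le:
  fixes f :: "nat \<Rightarrow> nat"
  assumes "v \<le> n"
  shows "(\<Sum>u\<le>n. if t \<le> u then if u \<le> v then f u else 0 else 0) = sum f {t..v}"
proof -
  have "(\<Sum>u\<le>n. if t \<le> u then if u \<le> v then f u else 0 else 0) = (\<Sum>u\<le>n. if t \<le> u \<and> u \<le> v then f u else 0)"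
    by (intro sum.cong refl) auto
  also have "\<dots> = sum f {u \<in> {..n}. t \<le> u \<and> u \<le> v}"
    by (rule sum.inter_filter[symmetric]) simp
  also have "{u \<in> {..n}. t \<le> u \<and> u \<le> v} = {t..v}" using assms by auto
  finally show ?thesis .
qed

text \<open>Here \<open>m - (p - 1) div k\<close> is the number of prescribed descents from \<open>p\<close> on, and
  \<open>((p - 1) div k + 1) * k - p\<close> the distance from \<open>p\<close> to the next multiple of \<open>k\<close>.\<close>

lemma codes_312:
  assumes "k > 0" "1 \<le> s" "s \<le> k" "p > 0" "p + n = m * k + s" "t \<le> n"
  shows "codes (\<lambda>p t u. if k dvd p then t = Suc u else t \<le> u) p n t
    = (if t \<le> m - (p - 1) div k
       then raney k (m - (p - 1) div k - t) (((p - 1) div k + 1) * k - p + (k - 1) * t) else 0)"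
  using assms(4-)
proof (induction n arbitrary: p t)
  case 0
  then have "p = m * k + s" by simp
  then have "(p - 1) div k = m" using div_last_block[OF assms(2,3), of m] by (simp only:)
  then show ?case using 0 by simp
next
  case (Suc n)
  let ?R = "\<lambda>p t u. if k dvd p then t = Suc u else t \<le> u"
  let ?q = "(p - 1) div k"
  have IH: "codes ?R (Suc p) n u = (if u \<le> m - p div k
       then raney k (m - p div k - u) ((p div k + 1) * k - Suc p + (k - 1) * u) else 0)" if "u \<le> n" for u
    using Suc.IH[of "Suc p" u] that Suc.prems by simp
  show ?case
  proof (cases "k dvd p")
    case True
    then obtain j where j: "p = k * j" by blast
    then obtain i where i: "j = Suc i" using Suc.prems(1) by (cases j) auto
    have q: "?q = i" unfolding j i using assms(1) by (intro div_nat_eqI) auto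
    have q': "p div k = Suc i" unfolding j i using assms(1) by simp
    have "Suc i * k + Suc n = m * k + s" using Suc.prems(2) unfolding j i by (simp only: mult.commute)
    moreover have "Suc m * k = m * k + k" by simp
    ultimately have "Suc i * k < Suc m * k" using assms(3) by linarith
    then have "Suc i < Suc m" unfolding mult_less_cancel2 by blast
    then have m: "m - i = Suc (m - Suc i)" by simp
    have a: "(i + 1) * k - p = 0" "(Suc i + 1) * k - Suc p = k - 1"
      unfolding j i by (simp_all add: mult.commute)
    show ?thesis
    proof (cases t)
      \<comment> \<open>An entry 0 cannot drop. The formula agrees, since \<open>m - i\<close> is
        positive and \<open>raney k (Suc _) 0 = 0\<close>.\<close>
      case 0
      then have "codes ?R p (Suc n) t = 0" using True by simp
      then show ?thesis unfolding q a m 0 by simp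
    next
      case (Suc u)
      then have "u \<le> n" using Suc.prems(3) by simp
      have "codes ?R p (Suc n) t = (\<Sum>v\<le>n. if v = u then codes ?R (Suc p) n u else 0)"
        unfolding codes.simps using True Suc by (intro sum.cong refl) auto
      also have "\<dots> = codes ?R (Suc p) n u" using \<open>u \<le> n\<close> by simp
      \<comment> \<open>Splitting \<open>(k - 1) * Suc u\<close> as \<open>k - 1\<close> plus
        \<open>(k - 1) * u\<close> yields the distance \<open>k - 1\<close> from
        \<open>p + 1\<close> to the next multiple.\<close>
      finally show ?thesis unfolding IH[OF \<open>u \<le> n\<close>] q q' a m Suc by simp
    qed
  next
    case False
    have q: "p div k = ?q"
      using Suc.prems(1) False div_Suc[of "p - 1" k] by (simp add: dvd_eq_mod_eq_0)
    have "p mod k < k" using assms(1) by simp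
    then have "p < (?q + 1) * k" using div_mult_mod_eq[of p k] unfolding q by simp
    then have a: "(?q + 1) * k - p = Suc ((?q + 1) * k - Suc p)" by linarith
    \<comment> \<open>The sum over \<open>u \<le> n\<close> must reach the cutoff
      \<open>m - ?q\<close> for the diagonal sum to be complete.\<close>
    have mn: "m - ?q \<le> n"
    proof (cases "?q < m")
      case True
      then obtain d where d: "m = Suc (?q + d)" using less_imp_Suc_add by blast
      have "m * k = (?q + 1) * k + d * k" by (subst d) (simp add: algebra_simps)
      then have "d * k + s \<le> n" using \<open>p < (?q + 1) * k\<close> Suc.prems(2) by linarith
      moreover have "d \<le> d * k" using assms(1) by simp
      ultimately show ?thesis using assms(2) d by linarith
    qed simp
    have "codes ?R p (Suc n) t = (\<Sum>u\<le>n. if t \<le> u then codes ?R (Suc p) n u else 0)"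
      using False by simp
    also have "\<dots> = (\<Sum>u\<le>n. if t \<le> u then if u \<le> m - ?q
       then raney k (m - ?q - u) ((?q + 1) * k - Suc p + (k - 1) * u) else 0 else 0)"
      unfolding q[symmetric] by (intro sum.cong refl) (subst IH, simp_all)
    also have "\<dots> = (\<Sum>u\<in>{t..m - ?q}. raney k (m - ?q - u) ((?q + 1) * k - Suc p + (k - 1) * u))"
      by (rule sum_if_le_and_le[OF mn])
    also have "\<dots> = (if t \<le> m - ?q then raney k (m - ?q - t) ((?q + 1) * k - p + (k - 1) * t) else 0)"
    proof (cases "t \<le> m - ?q")
      case True
      then show ?thesis unfolding a by (simp only: sum_raney_diagonal[OF True assms(1)] if_True)
    next
      case False
      then show ?thesis by simp
    qed
    finally show ?thesis .
  qed
qed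

text \<open>The sum over the first entry is once more a diagonal sum, where \<open>k - 1\<close> is
  the distance from position 1 to position \<open>k\<close>.\<close>

lemma card_D_avoiding_312:
  assumes "k \<ge> 2" "1 \<le> s" "s \<le> k"
  shows "card (D_avoiding (m * k + s) k [3, 1, 2]) = raney k m k"
proof -
  let ?N = "m * k + s"
  let ?R = "\<lambda>p t u. if k dvd p then t = Suc u else t \<le> u"
  have "m * 1 \<le> m * k" using assms by (intro mult_le_mono2) simp
  then have le: "m \<le> ?N - 1" using assms(2) unfolding mult_1_right by linarith
  have "card (D_avoiding ?N k [3, 1, 2]) = (\<Sum>t\<le>?N - 1. codes ?R 1 (?N - 1) t)"
    using assms by (intro card_D_avoiding_312_codes) auto
  also have "\<dots> = (\<Sum>t\<le>?N - 1. if 0 \<le> t then if t \<le> m then raney k (m - t) (k - 1 + (k - 1) * t) else 0 else 0)"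
  proof (rule sum.cong[OF refl])
    fix t assume "t \<in> {..?N - 1}"
    then have "t \<le> ?N - 1" by simp
    then show "codes ?R 1 (?N - 1) t
        = (if 0 \<le> t then if t \<le> m then raney k (m - t) (k - 1 + (k - 1) * t) else 0 else 0)"
      using codes_312[of k s 1 "?N - 1" m t] assms by simp
  qed
  also have "\<dots> = (\<Sum>t\<in>{0..m}. raney k (m - t) (k - 1 + (k - 1) * t))"
    by (rule sum_if_le_and_le[OF le])
  also have "\<dots> = raney k m k"
    using sum_raney_diagonal[of 0 m k "k - 1"] assms(1) by simp
  finally show ?thesis .
qed


section \<open>The pattern 213\<close>

text \<open>The hockey-stick identity, summed in reverse.\<close>

lemma sum_choose_diff:
  assumes "t \<le> n"
  shows "(\<Sum>u\<in>{t..<n}. (n - u - 1) choose r) = (n - t) choose Suc r"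
proof -
  have "(\<Sum>u\<in>{t..<n}. (n - u - 1) choose r) = (\<Sum>e<n - t. e choose r)"
    by (rule sum.reindex_bij_witness[of _ "\<lambda>e. n - 1 - e" "\<lambda>u. n - 1 - u"]) auto
  also have "\<dots> = (n - t) choose Suc r"
    by (cases "n - t") (simp_all add: lessThan_Suc_atMost sum_choose_upper)
  finally show ?thesis .
qed

context
  fixes R :: "nat \<Rightarrow> nat \<Rightarrow> nat \<Rightarrow> bool" and k N :: nat
  assumes R: "\<And>p t u. R p t u \<longleftrightarrow> (if k dvd p then u < t \<and> t = N - p else t \<le> u)"
begin

text \<open>Without a further descent the entries increase weakly up to the last one, which is 0, so
  all vanish. For \<open>n = 0\<close> the value of \<open>codes\<close> is 1 for every
  \<open>t\<close>.\<close>

lemma codes_213_last_block: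
  assumes "\<And>j. p \<le> j \<Longrightarrow> j < p + n \<Longrightarrow> \<not> k dvd j"
  shows "codes R p n t = (if t = 0 \<or> n = 0 then 1 else 0)"
  using assms
proof (induction n arbitrary: p t)
  case 0
  then show ?case by simp
next
  case (Suc n)
  have "\<not> k dvd p" using Suc.prems[of p] by simp
  then have "codes R p (Suc n) t = (\<Sum>u\<le>n. if t \<le> u then codes R (Suc p) n u else 0)" by (simp add: R)
  also have "\<dots> = (\<Sum>u\<le>n. if u = 0 then if t = 0 then 1 else 0 else 0)"
  proof (rule sum.cong[OF refl])
    fix u assume "u \<in> {..n}"
    moreover have "codes R (Suc p) n u = (if u = 0 \<or> n = 0 then 1 else 0)"
      using Suc.prems by (intro Suc.IH) auto
    ultimately show "(if t \<le> u then codes R (Suc p) n u else 0) = (if u = 0 then if t = 0 then 1 else 0 else 0)"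
      by auto
  qed
  finally show ?case by simp
qed

text \<open>The entries rise weakly from \<open>t\<close> to the forced value
  \<open>N - i * k\<close>, passing \<open>q\<close> free entries, which gives the binomial. After
  the descent every entry is allowed, so the rest splits off as a factor. The guard on
  \<open>t\<close> matters for \<open>q = 0\<close>, where truncation would give 1.\<close>

lemma codes_213_before_multiple:
  assumes "p + Suc q = i * k" "Suc q < k" "p + Suc n = N" "i * k + Suc r = N" "t \<le> Suc n"
  shows "codes R p (Suc n) t
    = (if t < Suc n then (n - t) choose q else 0) * (\<Sum>u\<le>r. codes R (Suc (i * k)) r u)"
    (is "_ = _ * ?W")
  using assms
proof (induction q arbitrary: p n t)
  case 0
  have nd: "\<not> k dvd p"
  proof
    assume "k dvd p"
    moreover have "k dvd p + 1" using 0(1) by simp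
    ultimately have "k dvd 1" using dvd_add_right_iff[of k p 1] by blast
    then show False using 0(2) by simp
  qed
  have n: "n = Suc r" and p: "Suc p = i * k" using 0 by auto
  \<comment> \<open>The entry at the multiple is forced to be \<open>n\<close>, and then every
    \<open>v \<le> r\<close> is below it.\<close>
  have each: "codes R (Suc p) n u = (if u = n then ?W else 0)" if "u \<le> n" for u
  proof -
    have "k dvd Suc p" by (simp only: p dvd_triv_right)
    moreover have "N - Suc p = n" using 0(3) by linarith
    ultimately have "R (Suc p) u v \<longleftrightarrow> u = n" if "v \<le> r" for v
      using that unfolding R n by auto
    then have "codes R (Suc p) n u = (\<Sum>v\<le>r. if u = n then codes R (Suc (Suc p)) r v else 0)"
      unfolding n codes.simps by (intro sum.cong refl) simp
    then show ?thesis unfolding p by simp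
  qed
  have "codes R p (Suc n) t = (\<Sum>u\<le>n. if t \<le> u then codes R (Suc p) n u else 0)"
    using nd by (simp add: R)
  also have "\<dots> = (\<Sum>u\<le>n. if u = n then if t \<le> n then ?W else 0 else 0)"
  proof (rule sum.cong[OF refl])
    fix u assume "u \<in> {..n}"
    then show "(if t \<le> u then codes R (Suc p) n u else 0)
        = (if u = n then if t \<le> n then ?W else 0 else 0)"
      unfolding atMost_iff by (cases "u = n") (simp_all only: each, simp_all)
  qed
  finally show ?case by simp
next
  case (Suc q)
  have "\<not> k dvd p"
  proof
    assume "k dvd p"
    moreover have "k dvd p + Suc (Suc q)" unfolding Suc.prems(1) by simp
    ultimately have "k dvd Suc (Suc q)" using dvd_add_right_iff[of k p "Suc (Suc q)"] by blast
    then show False using Suc.prems(2) by (auto dest: dvd_imp_le)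
  qed
  obtain n' where n: "n = Suc n'" using Suc.prems(1,3,4) by (cases n) auto
  have IH: "codes R (Suc p) n u = (if u < n then (n - u - 1) choose q else 0) * ?W" if "u \<le> n" for u
    using Suc.IH[of "Suc p" n' u] Suc.prems that unfolding n by simp
  have "codes R p (Suc n) t = (\<Sum>u\<le>n. if t \<le> u then codes R (Suc p) n u else 0)"
    using \<open>\<not> k dvd p\<close> by (simp add: R)
  also have "\<dots> = (\<Sum>u\<le>n. (if t \<le> u \<and> u < n then (n - u - 1) choose q else 0) * ?W)"
    by (intro sum.cong refl) (simp add: IH)
  also have "\<dots> = (\<Sum>u\<le>n. if t \<le> u \<and> u < n then (n - u - 1) choose q else 0) * ?W"
    by (rule sum_distrib_right[symmetric])
  also have "(\<Sum>u\<le>n. if t \<le> u \<and> u < n then (n - u - 1) choose q else 0)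
      = (\<Sum>u\<in>{u \<in> {..n}. t \<le> u \<and> u < n}. (n - u - 1) choose q)"
    by (rule sum.inter_filter[symmetric]) simp
  also have "{u \<in> {..n}. t \<le> u \<and> u < n} = {t..<n}" by auto
  also have "(\<Sum>u\<in>{t..<n}. (n - u - 1) choose q) = (if t < Suc n then (n - t) choose Suc q else 0)"
    using sum_choose_diff[of t n q] by simp
  finally show ?case .
qed

text \<open>Induction on the number \<open>j\<close> of descents still to come, from the last block
  leftwards. Each new block adds one factor, summed over its first entry by the hockey-stick
  identity.\<close>

lemma sum_codes_213:
  assumes "k \<ge> 2" "1 \<le> s" "s \<le> k" "N = m * k + s" "j \<le> m"
  shows "(\<Sum>t\<le>s + j * k - 1. codes R ((m - j) * k + 1) (s + j * k - 1) t)
    = (\<Prod>i=1..j. (s + i * k - 1) choose (k - 1))"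
  using assms(5)
proof (induction j)
  case 0
  have c: "codes R (m * k + 1) (s - 1) t = (if t = 0 \<or> s - 1 = 0 then 1 else 0)" for t
  proof (rule codes_213_last_block)
    fix j assume "m * k + 1 \<le> j" "j < m * k + 1 + (s - 1)"
    then have "j - m * k > 0" "j - m * k < k" "j = m * k + (j - m * k)" using assms(2,3) by linarith+
    then show "\<not> k dvd j"
      using dvd_add_right_iff[of k "m * k" "j - m * k"] by (auto dest: dvd_imp_le)
  qed
  have "(\<Sum>t\<le>s - 1. codes R (m * k + 1) (s - 1) t) = (\<Sum>t\<le>s - 1. if t = 0 then 1 else 0)"
    unfolding c by (intro sum.cong refl) auto
  then show ?case by simp
next
  case (Suc j)
  let ?p = "(m - Suc j) * k + 1"
  define r where "r = s + j * k - 1"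
  define n where "n = s + Suc j * k - 2"
  have n: "s + Suc j * k - 1 = Suc n" using assms(1,2) unfolding n_def by simp
  have r: "s + j * k - 1 = r" by (simp add: r_def)
  have mj: "m - j = Suc (m - Suc j)" using Suc.prems by simp
  have "m * k = (m - Suc j) * k + Suc j * k"
    unfolding add_mult_distrib[symmetric] using Suc.prems by (simp only: le_add_diff_inverse2)
  then have N: "N = (m - Suc j) * k + Suc j * k + s" using assms(4) by simp
  \<comment> \<open>A block starts \<open>k - 1\<close> positions before the next multiple, so
    \<open>codes_213_before_multiple\<close> is used with \<open>q = k - 2\<close>.\<close>
  have e: "?p + Suc (k - 2) = (m - j) * k" "?p + Suc n = N" "(m - j) * k + Suc r = N"
    unfolding N n[symmetric] mj r_def using assms(1,2) by simp_all
  have "(\<Sum>t\<le>Suc n. codes R ?p (Suc n) t)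
      = (\<Sum>t\<le>Suc n. (if t < Suc n then (n - t) choose (k - 2) else 0) * (\<Sum>u\<le>r. codes R (Suc ((m - j) * k)) r u))"
    using assms(1) by (intro sum.cong refl codes_213_before_multiple[OF e(1) _ e(2,3)]) auto
  also have "\<dots> = (\<Sum>t\<le>Suc n. if t < Suc n then (n - t) choose (k - 2) else 0) *
      (\<Sum>u\<le>r. codes R (Suc ((m - j) * k)) r u)"
    by (rule sum_distrib_right[symmetric])
  also have "(\<Sum>t\<le>Suc n. if t < Suc n then (n - t) choose (k - 2) else 0)
      = (\<Sum>t\<in>{0..<Suc n}. (Suc n - t - 1) choose (k - 2))"
    by (simp add: atLeast0LessThan lessThan_Suc_atMost)
  also have "\<dots> = Suc n choose (k - 1)"
    using sum_choose_diff[of 0 "Suc n" "k - 2"] assms(1) by (simp add: numeral_2_eq_2 Suc_diff_Suc)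
  also have "(\<Sum>u\<le>r. codes R (Suc ((m - j) * k)) r u) = (\<Prod>i=1..j. (s + i * k - 1) choose (k - 1))"
    using Suc unfolding r by simp
  finally have "(\<Sum>t\<le>Suc n. codes R ?p (Suc n) t)
      = (Suc n choose (k - 1)) * (\<Prod>i=1..j. (s + i * k - 1) choose (k - 1))" .
  moreover have "(\<Prod>i=1..Suc j. (s + i * k - 1) choose (k - 1))
      = (Suc n choose (k - 1)) * (\<Prod>i=1..j. (s + i * k - 1) choose (k - 1))"
    unfolding n[symmetric] by (simp only: prod.cl_ivl_Suc) simp
  ultimately show ?case unfolding n by (simp only:)
qed

end

lemma card_D_avoiding_213:
  assumes "k \<ge> 2" "1 \<le> s" "s \<le> k"
  shows "card (D_avoiding (m * k + s) k [2, 1, 3]) = (\<Prod>j=1..m. (s + j * k - 1) choose (k - 1))"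
proof -
  let ?N = "m * k + s"
  let ?R = "\<lambda>p t u. if k dvd p then u < t \<and> t = ?N - p else t \<le> u"
  have "card (D_avoiding ?N k [2, 1, 3]) = (\<Sum>t\<le>?N - 1. codes ?R 1 (?N - 1) t)"
    using assms by (intro card_D_avoiding_213_codes) auto
  also have "\<dots> = (\<Prod>j=1..m. (s + j * k - 1) choose (k - 1))"
    using sum_codes_213[of ?R k ?N s m m, OF refl assms refl order_refl]
    by (simp only: diff_self_eq_0 mult_0 add_0 add.commute[of s])
  finally show ?thesis .
qed

section \<open>The pattern 123\<close>

lemma permutes_neq:
  "\<pi> permutes A \<Longrightarrow> i \<noteq> j \<Longrightarrow> \<pi> i \<noteq> \<pi> j"
  by (metis permutes_inj injD)

text \<open>The first two positions are ascents, so the first three letters form a 123.\<close>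

lemma D_avoiding_123_eq_empty:
  assumes "k \<ge> 3" "N \<ge> 3"
  shows "D_avoiding N k [1, 2, 3] = {}"
proof (rule equals0I)
  fix \<pi> assume "\<pi> \<in> D_avoiding N k [1, 2, 3]"
  then have \<pi>: "\<pi> permutes {1..N}"
    and des: "\<And>i. 1 \<le> i \<Longrightarrow> i < N \<Longrightarrow> \<pi> (Suc i) < \<pi> i \<longleftrightarrow> k dvd i"
    and pat: "\<And>i j. 1 \<le> i \<Longrightarrow> i < N \<Longrightarrow> Suc i < j \<Longrightarrow> j \<le> N \<Longrightarrow> \<not> (\<pi> i < \<pi> (Suc i) \<and> \<pi> (Suc i) < \<pi> j)"
    using assms(1) by (simp_all add: D_avoiding_iff same_relative_order_patterns del: One_nat_def)
  have "\<not> k dvd 1" "\<not> k dvd 2" using assms(1) by (auto dest: dvd_imp_le)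
  then have "\<pi> 1 \<le> \<pi> 2" "\<pi> 2 \<le> \<pi> 3"
    using des[of 1] des[of 2] assms(2) by (simp_all add: numeral_2_eq_2 numeral_3_eq_3)
  moreover have "\<pi> 1 \<noteq> \<pi> 2" "\<pi> 2 \<noteq> \<pi> 3" using permutes_neq[OF \<pi>] by simp_all
  ultimately show False using pat[of 1 3] assms(2) by (simp add: numeral_2_eq_2 numeral_3_eq_3)
qed

text \<open>Ascents and descents alternate, so the middle value of either pattern is a peak. A 213
  at \<open>i\<close> gives a 123 at \<open>i - 1\<close> with the same last letter. A 123 at
  \<open>i\<close> gives a 213 at \<open>i + 1\<close>, because \<open>j = i + 2\<close> would
  contradict the descent.\<close>

lemma D_avoiding_2_123: "D_avoiding N 2 [1, 2, 3] = D_avoiding N 2 [2, 1, 3]"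
proof -
  have "(\<forall>i\<in>{1..<N}. \<forall>j\<in>{Suc i<..N}. \<not> (\<pi> i < \<pi> (Suc i) \<and> \<pi> (Suc i) < \<pi> j)) \<longleftrightarrow>
      (\<forall>i\<in>{1..<N}. \<forall>j\<in>{Suc i<..N}. \<not> (\<pi> (Suc i) < \<pi> i \<and> \<pi> i < \<pi> j))" (is "?l \<longleftrightarrow> ?r")
    if \<pi>: "\<pi> permutes {1..N}" and des: "\<forall>i\<in>{1..<N}. \<pi> (Suc i) < \<pi> i \<longleftrightarrow> even i" for \<pi> :: "nat \<Rightarrow> nat"
  proof
    assume l: ?l
    show ?r
    proof (intro ballI notI)
      fix i j assume i: "i \<in> {1..<N}" and j: "j \<in> {Suc i<..N}" and a: "\<pi> (Suc i) < \<pi> i \<and> \<pi> i < \<pi> j"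
      have "even i" using des i a by blast
      then obtain h where h: "i = Suc h" "h \<ge> 1" using i by (cases i) (auto intro: Suc_leI gr0I)
      have "h \<in> {1..<N}" using i h by simp
      moreover have "odd h" using \<open>even i\<close> h(1) by simp
      ultimately have "\<not> \<pi> (Suc h) < \<pi> h" using des by blast
      moreover have "\<pi> h \<noteq> \<pi> (Suc h)" using permutes_neq[OF \<pi>] by simp
      ultimately have "\<pi> h < \<pi> (Suc h) \<and> \<pi> (Suc h) < \<pi> j" using a h(1) by simp
      moreover have "j \<in> {Suc h<..N}" using j h(1) by simp
      ultimately show False using l \<open>h \<in> {1..<N}\<close> by blast
    qed
  next
    assume r: ?r
    show ?l
    proof (intro ballI notI)
      fix i j assume i: "i \<in> {1..<N}" and j: "j \<in> {Suc i<..N}" and a: "\<pi> i < \<pi> (Suc i) \<and> \<pi> (Suc i) < \<pi> j"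
      have "\<not> \<pi> (Suc i) < \<pi> i" using a by simp
      then have "odd i" using des i by blast
      then have "even (Suc i)" by simp
      have "Suc i \<in> {1..<N}" using j by simp
      then have d: "\<pi> (Suc (Suc i)) < \<pi> (Suc i)" using des \<open>even (Suc i)\<close> by blast
      then have "j \<noteq> Suc (Suc i)" using a by auto
      then have "j \<in> {Suc (Suc i)<..N}" using j by simp
      then show False using r \<open>Suc i \<in> {1..<N}\<close> a d by blast
    qed
  qed
  then have "\<pi> \<in> D_avoiding N 2 [1, 2, 3] \<longleftrightarrow> \<pi> \<in> D_avoiding N 2 [2, 1, 3]" for \<pi>
    unfolding D_avoiding_iff[OF pos2] same_relative_order_patterns ball_conj_distrib by blast
  then show ?thesis by blast
qed

section \<open>Permutations as linear orders\<close>

text \<open>Recovers a permutation from the comparisons between its values, which gives injectivity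
  of \<open>order_of\<close>.\<close>

lemma card_less_eq_permutes:
  assumes "\<pi> permutes {1..N}" "i \<in> {1..N}"
  shows "card {j \<in> {1..N}. \<pi> j \<le> \<pi> i} = \<pi> i"
proof -
  have img: "\<pi> ` {1..N} = {1..N}" by (rule permutes_image[OF assms(1)])
  have "\<pi> i \<in> {1..N}" using permutes_in_image[OF assms(1)] assms(2) by blast
  then have "{1..\<pi> i} = {v \<in> {1..N}. v \<le> \<pi> i}" by auto
  also have "\<dots> = {v \<in> \<pi> ` {1..N}. v \<le> \<pi> i}" unfolding img ..
  also have "\<dots> = \<pi> ` {j \<in> {1..N}. \<pi> j \<le> \<pi> i}" by blast
  finally have "card {1..\<pi> i} = card (\<pi> ` {j \<in> {1..N}. \<pi> j \<le> \<pi> i})" by (rule arg_cong)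
  moreover have "card (\<pi> ` {j \<in> {1..N}. \<pi> j \<le> \<pi> i}) = card {j \<in> {1..N}. \<pi> j \<le> \<pi> i}"
    by (rule card_image[OF permutes_inj_on[OF assms(1)]])
  ultimately show ?thesis by simp
qed

definition order_of :: "('a \<Rightarrow> nat) \<Rightarrow> 'a set \<Rightarrow> (nat \<Rightarrow> nat) \<Rightarrow> 'a rel" where
  "order_of pos A \<pi> = {(x, y). x \<in> A \<and> y \<in> A \<and> \<pi> (pos x) \<le> \<pi> (pos y)}"

lemma linear_order_on_order_of:
  assumes "inj_on pos A" "\<pi> permutes B"
  shows "linear_order_on A (order_of pos A \<pi>)"
proof -
  have "x = y" if "x \<in> A" "y \<in> A" "\<pi> (pos x) = \<pi> (pos y)" for x y
    using that assms(1) permutes_neq[OF assms(2)] by (meson inj_onD)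
  then show ?thesis
    unfolding order_on_defs order_of_def refl_on_def trans_def antisym_on_def total_on_def
    by (auto intro: antisym)
qed

text \<open>Down-sets of a linear order are nested, strictly so for distinct elements because each
  contains its own top; their sizes therefore encode the order.\<close>

lemma bij_betw_linear_order_rank:
  assumes "linear_order_on A l" "finite A"
  shows "bij_betw (\<lambda>x. card {y \<in> A. (y, x) \<in> l}) A {1..card A}"
    and "\<And>x y. x \<in> A \<Longrightarrow> y \<in> A \<Longrightarrow> (x, y) \<in> l \<longleftrightarrow> card {z \<in> A. (z, x) \<in> l} \<le> card {z \<in> A. (z, y) \<in> l}"
proof -
  let ?f = "\<lambda>x. card {y \<in> A. (y, x) \<in> l}"
  have l: "refl_on A l" "trans l" "antisym l" "total_on A l"
    using assms(1) unfolding order_on_defs by auto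
  have le: "?f x \<le> ?f y" if "(x, y) \<in> l" for x y
    using that assms(2) transD[OF l(2)] by (intro card_mono) auto
  have less: "?f x < ?f y" if "(x, y) \<in> l" "x \<noteq> y" "y \<in> A" for x y
  proof (rule psubset_card_mono)
    have "(y, x) \<notin> l" using that antisymD[OF l(3)] by blast
    moreover have "(y, y) \<in> l" using l(1) that(3) unfolding refl_on_def by blast
    moreover have "{z \<in> A. (z, x) \<in> l} \<subseteq> {z \<in> A. (z, y) \<in> l}" using that(1) transD[OF l(2)] by blast
    ultimately show "{z \<in> A. (z, x) \<in> l} \<subset> {z \<in> A. (z, y) \<in> l}" using that(3) by blast
  qed (use assms(2) in simp)
  show iff: "(x, y) \<in> l \<longleftrightarrow> ?f x \<le> ?f y" if "x \<in> A" "y \<in> A" for x y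
  proof
    assume "?f x \<le> ?f y"
    then have "x = y \<or> (y, x) \<notin> l" using less[of y x] that(1) by force
    then show "(x, y) \<in> l" using l(1,4) that unfolding refl_on_def total_on_def by (cases "x = y") auto
  qed (rule le)
  have "inj_on ?f A"
  proof (rule inj_onI)
    fix x y assume "x \<in> A" "y \<in> A" "?f x = ?f y"
    then have "(x, y) \<in> l" "(y, x) \<in> l" using iff by simp_all
    then show "x = y" using antisymD[OF l(3)] by blast
  qed
  moreover have "?f ` A \<subseteq> {1..card A}"
  proof (rule image_subsetI)
    fix x assume x: "x \<in> A"
    then have "x \<in> {y \<in> A. (y, x) \<in> l}" using l(1) unfolding refl_on_def by blast
    then have "?f x > 0" using assms(2) by (simp add: card_gt_0_iff) blast
    moreover have "?f x \<le> card A" using assms(2) by (intro card_mono) auto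
    ultimately show "?f x \<in> {1..card A}" by simp
  qed
  ultimately show "bij_betw ?f A {1..card A}"
    by (simp add: bij_betw_def card_subset_eq card_image)
qed

lemma bij_betw_order_of:
  assumes "bij_betw pos A {1..N}"
  shows "bij_betw (order_of pos A) {\<pi>. \<pi> permutes {1..N}} {l. linear_order_on A l}"
  unfolding bij_betw_def
proof (intro conjI equalityI subsetI)
  have pos: "inj_on pos A" "pos ` A = {1..N}" using assms by (simp_all add: bij_betw_def)
  have A: "finite A" "card A = N"
    using bij_betw_finite[OF assms] bij_betw_same_card[OF assms] by simp_all
  show "inj_on (order_of pos A) {\<pi>. \<pi> permutes {1..N}}"
  proof (rule inj_onI)
    fix \<pi> \<sigma> assume "\<pi> \<in> {\<pi>. \<pi> permutes {1..N}}" "\<sigma> \<in> {\<pi>. \<pi> permutes {1..N}}"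
      and eq: "order_of pos A \<pi> = order_of pos A \<sigma>"
    then have p: "\<pi> permutes {1..N}" "\<sigma> permutes {1..N}" by auto
    have "\<pi> (pos x) \<le> \<pi> (pos y) \<longleftrightarrow> \<sigma> (pos x) \<le> \<sigma> (pos y)" if "x \<in> A" "y \<in> A" for x y
    proof -
      have "(x, y) \<in> order_of pos A \<pi> \<longleftrightarrow> (x, y) \<in> order_of pos A \<sigma>" using eq by simp
      then show ?thesis using that by (simp add: order_of_def)
    qed
    then have iff: "\<pi> i \<le> \<pi> j \<longleftrightarrow> \<sigma> i \<le> \<sigma> j" if "i \<in> {1..N}" "j \<in> {1..N}" for i j
      using that unfolding pos(2)[symmetric] by blast
    show "\<pi> = \<sigma>"
    proof
      fix i show "\<pi> i = \<sigma> i"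
      proof (cases "i \<in> {1..N}")
        case True
        then have "{j \<in> {1..N}. \<pi> j \<le> \<pi> i} = {j \<in> {1..N}. \<sigma> j \<le> \<sigma> i}" using iff by blast
        then show ?thesis using card_less_eq_permutes[OF p(1) True] card_less_eq_permutes[OF p(2) True] by simp
      next
        case False
        then show ?thesis using permutes_not_in[OF p(1)] permutes_not_in[OF p(2)] by simp
      qed
    qed
  qed
  fix l
  show "l \<in> {l. linear_order_on A l}" if "l \<in> order_of pos A ` {\<pi>. \<pi> permutes {1..N}}"
    using that linear_order_on_order_of[OF pos(1)] by blast
  show "l \<in> order_of pos A ` {\<pi>. \<pi> permutes {1..N}}" if "l \<in> {l. linear_order_on A l}"
  proof -
    have lin: "linear_order_on A l" using that by simp
    let ?f = "\<lambda>x. card {y \<in> A. (y, x) \<in> l}"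
    \<comment> \<open>The preimage of \<open>l\<close>: each position receives the rank of the
      element placed there.\<close>
    define \<sigma> where "\<sigma> i = (if i \<in> {1..N} then ?f (inv_into A pos i) else i)" for i
    note rank = bij_betw_linear_order_rank[OF lin A(1), unfolded A(2)]
    have "bij_betw (?f \<circ> inv_into A pos) {1..N} {1..N}"
      by (rule bij_betw_trans[OF bij_betw_inv_into[OF assms] rank(1)])
    moreover have "bij_betw \<sigma> {1..N} {1..N} \<longleftrightarrow> bij_betw (?f \<circ> inv_into A pos) {1..N} {1..N}"
      by (rule bij_betw_cong) (simp add: \<sigma>_def)
    ultimately have "bij_betw \<sigma> {1..N} {1..N}" by (simp only:)
    then have \<sigma>: "\<sigma> permutes {1..N}" by (rule bij_imp_permutes) (simp only: \<sigma>_def if_False)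
    have val: "\<sigma> (pos x) = ?f x" if "x \<in> A" for x
    proof -
      have "pos x \<in> {1..N}" using that pos(2) by blast
      then show ?thesis unfolding \<sigma>_def using inv_into_f_f[OF pos(1) that] by (simp only: if_True)
    qed
    have sub: "l \<subseteq> A \<times> A" using lin unfolding order_on_defs by blast
    have "(x, y) \<in> l \<longleftrightarrow> (x, y) \<in> order_of pos A \<sigma>" for x y
    proof (cases "x \<in> A \<and> y \<in> A")
      case True
      then show ?thesis using rank(2)[of x y] val by (simp add: order_of_def)
    next
      case False
      then show ?thesis using sub by (auto simp: order_of_def)
    qed
    then have "l = order_of pos A \<sigma>" by (auto simp: set_eq_iff)
    then show ?thesis using \<sigma> by blast
  qed
qed


section \<open>The pattern 321\<close>

context
  fixes m s k :: nat
  assumes s: "1 \<le> s" "s \<le> k"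
begin

lemma block_elems_iff:
  "(i, a) \<in> block_elems m s k \<longleftrightarrow> 1 \<le> i \<and> i \<le> m + 1 \<and> 1 \<le> a \<and> a \<le> (if i \<le> m then k else s)"
  by (simp add: block_elems_def)

text \<open>The inverse is division of \<open>p - 1\<close> by \<open>k\<close> with remainder; the
  shifts by one come from numbering blocks and places from 1.\<close>

lemma bij_betw_block_pos: "bij_betw (block_pos k) (block_elems m s k) {1..m * k + s}"
proof (rule bij_betw_byWitness[where f' = "\<lambda>p. ((p - 1) div k + 1, (p - 1) mod k + 1)"])
  show "\<forall>x\<in>block_elems m s k. ((block_pos k x - 1) div k + 1, (block_pos k x - 1) mod k + 1) = x"
  proof
    fix y assume y: "y \<in> block_elems m s k"
    obtain i a where ia: "y = (i, a)" by (cases y)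
    have x: "1 \<le> i" "1 \<le> a" "a \<le> k" using y s unfolding ia block_elems_iff by (auto split: if_splits)
    obtain b where b: "a = Suc b" "b < k" using x(2,3) by (cases a) auto
    have "block_pos k (i, a) - 1 = b + (i - 1) * k"
      by (simp add: block_pos_def b)
    then show "((block_pos k y - 1) div k + 1, (block_pos k y - 1) mod k + 1) = y"
      unfolding ia
      using x(1) b by simp
  qed
  show "\<forall>p\<in>{1..m * k + s}. block_pos k ((p - 1) div k + 1, (p - 1) mod k + 1) = p"
  proof
    fix p assume "p \<in> {1..m * k + s}"
    then show "block_pos k ((p - 1) div k + 1, (p - 1) mod k + 1) = p"
      using div_mult_mod_eq[of "p - 1" k] by (simp add: block_pos_def)
  qed
  show "block_pos k ` block_elems m s k \<subseteq> {1..m * k + s}"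
  proof (rule image_subsetI)
    fix y assume y: "y \<in> block_elems m s k"
    obtain i a where ia: "y = (i, a)" by (cases y)
    note x = y[unfolded ia]
    have "(i - 1) * k + a \<le> m * k + s"
    proof (cases "i \<le> m")
      case True
      then have "i * k \<le> m * k" by (rule mult_le_mono1)
      moreover have "(i - 1) * k + k = i * k" using x unfolding block_elems_iff by (cases i) auto
      moreover have "a \<le> k" using x True unfolding block_elems_iff by simp
      ultimately show ?thesis by linarith
    next
      case False
      then have "i - 1 = m" "a \<le> s" using x unfolding block_elems_iff by auto
      then show ?thesis by simp
    qed
    moreover have "1 \<le> a" using x unfolding block_elems_iff by simp
    ultimately show "block_pos k y \<in> {1..m * k + s}" by (simp add: block_pos_def ia)
  qed
  show "(\<lambda>p. ((p - 1) div k + 1, (p - 1) mod k + 1)) ` {1..m * k + s} \<subseteq> block_elems m s k"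
  proof (rule image_subsetI)
    fix p assume p: "p \<in> {1..m * k + s}"
    have "(p - 1) div k \<le> (m * k + s - 1) div k" using p by (intro div_le_mono) auto
    then have le: "(p - 1) div k \<le> m" unfolding div_last_block[OF s] .
    have "(p - 1) mod k < k" using s by (intro mod_less_divisor) simp
    \<comment> \<open>The last block has only \<open>s\<close> places.\<close>
    moreover have "(p - 1) mod k < s" if "(p - 1) div k = m"
      using div_mult_mod_eq[of "p - 1" k] p unfolding that atLeastAtMost_iff by linarith
    ultimately show "((p - 1) div k + 1, (p - 1) mod k + 1) \<in> block_elems m s k"
      using le unfolding block_elems_iff by (auto simp: Suc_le_eq)
  qed
qed

text \<open>A transitive relation contains a transitive closure as soon as it contains the
  generators, so both closures disappear.\<close>

lemma P321_subset_iff: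
  assumes "trans l" "Id_on (block_elems m s k) \<subseteq> l"
  shows "P321 m s k \<subseteq> l \<longleftrightarrow>
    (\<forall>i a. (i, a) \<in> block_elems m s k \<longrightarrow> (i, a + 1) \<in> block_elems m s k \<longrightarrow> ((i, a), (i, a + 1)) \<in> l) \<and>
    (\<forall>i. 1 \<le> i \<longrightarrow> i \<le> m \<longrightarrow> ((i + 1, 1), (i, k)) \<in> l) \<and>
    (\<forall>i y. 1 \<le> i \<longrightarrow> i \<le> m \<longrightarrow> y \<in> block_elems m s k \<longrightarrow> block_pos k (i + 1, 1) < block_pos k y \<longrightarrow>
       ((i + 1, 1), y) \<in> l)" (is "_ \<longleftrightarrow> ?a \<and> ?b \<and> ?c")
proof -
  have trancl: "r\<^sup>+ \<subseteq> l \<longleftrightarrow> r \<subseteq> l" for r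
  proof
    assume "r \<subseteq> l"
    then show "r\<^sup>+ \<subseteq> l" using trancl_mono[of _ r l] unfolding trancl_id[OF assms(1)] by blast
  qed (auto intro: r_into_trancl)
  have gens: "block_gens m s k \<subseteq> l \<longleftrightarrow> ?a \<and> ?b"
    unfolding block_gens_def Un_subset_iff by blast
  show ?thesis
    unfolding P321_def block_poset_def trancl Un_subset_iff gens using assms(2) by blast
qed

text \<open>The three families of generators are read as inequalities: \<open>A\<close> gives the
  ascents inside blocks, \<open>B\<close> the descents between blocks, and \<open>C\<close> says
  that the bottom of each descent lies below everything later, so no 321 starts there.\<close>

lemma P321_subset_order_of_iff:
  assumes \<pi>: "\<pi> permutes {1..m * k + s}" and "k \<ge> 2"
  shows "P321 m s k \<subseteq> order_of (block_pos k) (block_elems m s k) \<pi> \<longleftrightarrow>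
    \<pi> \<in> D_avoiding (m * k + s) k [3, 2, 1]"
proof -
  let ?N = "m * k + s" and ?A = "block_elems m s k" and ?l = "order_of (block_pos k) (block_elems m s k) \<pi>"
  have "linear_order_on ?A ?l"
    using bij_betw_block_pos \<pi> by (intro linear_order_on_order_of) (auto simp: bij_betw_def)
  then have l: "trans ?l" "Id_on ?A \<subseteq> ?l"
    unfolding order_on_defs refl_on_def by auto
  have first: "(i + 1, 1) \<in> ?A" and last: "(i, k) \<in> ?A" if "1 \<le> i" "i \<le> m" for i
    using that s by (simp_all add: block_elems_iff)
  have pos: "block_pos k (i, a) = (i - 1) * k + a" for i a by (simp add: block_pos_def)
  have pos_last: "block_pos k (i, k) = i * k" if "1 \<le> i" for i using that by (cases i) (simp_all add: pos)
  have pos_first: "block_pos k (i + 1, 1) = Suc (i * k)" for i by (simp add: pos)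
  have onto: "\<exists>x\<in>?A. block_pos k x = p" if "p \<in> {1..?N}" for p
    using that unfolding bij_betw_imp_surj_on[OF bij_betw_block_pos, symmetric] by blast
  have multiple: "\<exists>i. 1 \<le> i \<and> i \<le> m \<and> p = i * k" if p: "p \<in> {1..<?N}" "k dvd p" for p
  proof -
    obtain i where i: "p = i * k" using p(2) by (metis dvd_div_mult_self)
    have "i * k < Suc m * k" using p(1) s(2) unfolding i by simp
    then have "i \<le> m" unfolding mult_less_cancel2 by simp
    moreover have "1 \<le> i" using p(1) i by (cases i) auto
    ultimately show ?thesis using i by blast
  qed
  have before: "i * k \<in> {1..<?N}" if "1 \<le> i" "i \<le> m" for i
  proof -
    have "i * k \<le> m * k" "1 * k \<le> i * k" using that by (intro mult_le_mono1; simp)+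
    then have "1 \<le> i * k" "i * k < ?N" using s unfolding mult_1 by linarith+
    then show ?thesis by simp
  qed
  have A: "(\<forall>i a. (i, a) \<in> ?A \<longrightarrow> (i, a + 1) \<in> ?A \<longrightarrow> ((i, a), (i, a + 1)) \<in> ?l)
      \<longleftrightarrow> (\<forall>p\<in>{1..<?N}. \<not> k dvd p \<longrightarrow> \<pi> p \<le> \<pi> (Suc p))" (is "?a \<longleftrightarrow> ?a'")
  proof
    assume a: ?a
    show ?a'
    proof (intro ballI impI)
      fix p assume p: "p \<in> {1..<?N}" "\<not> k dvd p"
      obtain i a where x: "(i, a) \<in> ?A" "block_pos k (i, a) = p" using onto[of p] p(1) by auto
      \<comment> \<open>\<open>a = k\<close> would make \<open>p\<close> a multiple of
        \<open>k\<close>, and \<open>a = s\<close> in the last block would make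
        \<open>p = N\<close>; so the block continues after \<open>a\<close>.\<close>
      have "a \<noteq> k" using x(2) p(2) unfolding pos by auto
      moreover have "a \<noteq> s" if "i = m + 1" using x(2) p(1) that unfolding pos by auto
      ultimately have "(i, a + 1) \<in> ?A" using x(1) unfolding block_elems_iff by auto
      then have "((i, a), (i, a + 1)) \<in> ?l" using a x(1) by blast
      then show "\<pi> p \<le> \<pi> (Suc p)" using x(2) by (auto simp: order_of_def pos)
    qed
  next
    assume a: ?a'
    show ?a
    proof (intro allI impI)
      fix i a assume x: "(i, a) \<in> ?A" "(i, a + 1) \<in> ?A"
      have "block_pos k (i, a) \<in> {1..?N}" "block_pos k (i, a + 1) \<in> {1..?N}"
        using x bij_betwE[OF bij_betw_block_pos] by blast+
      then have "block_pos k (i, a) \<in> {1..<?N}" unfolding pos by auto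
      moreover have "\<not> k dvd block_pos k (i, a)"
      proof
        assume "k dvd block_pos k (i, a)"
        then have "k dvd a" unfolding pos using dvd_add_right_iff[of k "(i - 1) * k" a] by simp
        then have "k \<le> a" using x(1) unfolding block_elems_iff by (auto dest: dvd_imp_le)
        then show False using x(2) s unfolding block_elems_iff by (auto split: if_splits)
      qed
      ultimately have "\<pi> (block_pos k (i, a)) \<le> \<pi> (Suc (block_pos k (i, a)))" using a by blast
      then show "((i, a), (i, a + 1)) \<in> ?l" using x by (simp add: order_of_def pos)
    qed
  qed
  have B: "(\<forall>i. 1 \<le> i \<longrightarrow> i \<le> m \<longrightarrow> ((i + 1, 1), (i, k)) \<in> ?l)
      \<longleftrightarrow> (\<forall>p\<in>{1..<?N}. k dvd p \<longrightarrow> \<pi> (Suc p) \<le> \<pi> p)" (is "?b \<longleftrightarrow> ?b'")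
  proof -
    have "((i + 1, 1), (i, k)) \<in> ?l \<longleftrightarrow> \<pi> (Suc (i * k)) \<le> \<pi> (i * k)" if "1 \<le> i" "i \<le> m" for i
      using first[OF that] last[OF that] pos_first pos_last[OF that(1)] by (simp add: order_of_def)
    then have "?b \<longleftrightarrow> (\<forall>i. 1 \<le> i \<longrightarrow> i \<le> m \<longrightarrow> \<pi> (Suc (i * k)) \<le> \<pi> (i * k))" by blast
    also have "\<dots> \<longleftrightarrow> ?b'" using multiple before dvd_triv_right[of k] by blast
    finally show ?thesis .
  qed
  have C: "(\<forall>i y. 1 \<le> i \<longrightarrow> i \<le> m \<longrightarrow> y \<in> ?A \<longrightarrow> block_pos k (i + 1, 1) < block_pos k y \<longrightarrow> ((i + 1, 1), y) \<in> ?l)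
      \<longleftrightarrow> (\<forall>p\<in>{1..<?N}. k dvd p \<longrightarrow> (\<forall>j\<in>{Suc p<..?N}. \<pi> (Suc p) \<le> \<pi> j))" (is "?c \<longleftrightarrow> ?c'")
  proof -
    have range: "block_pos k y \<in> {1..?N}" if "y \<in> ?A" for y
      using that bij_betwE[OF bij_betw_block_pos] by blast
    have "(\<forall>y. y \<in> ?A \<longrightarrow> block_pos k (i + 1, 1) < block_pos k y \<longrightarrow> ((i + 1, 1), y) \<in> ?l)
        \<longleftrightarrow> (\<forall>j\<in>{Suc (i * k)<..?N}. \<pi> (Suc (i * k)) \<le> \<pi> j)" (is "?u \<longleftrightarrow> ?v") if "1 \<le> i" "i \<le> m" for i
    proof
      assume u: ?u
      show ?v
      proof
        fix j assume j: "j \<in> {Suc (i * k)<..?N}"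
        then obtain y where y: "y \<in> ?A" "block_pos k y = j" using onto[of j] by auto
        then have "block_pos k (i + 1, 1) < block_pos k y" using j unfolding pos_first by simp
        then have "((i + 1, 1), y) \<in> ?l" using u y(1) by blast
        then show "\<pi> (Suc (i * k)) \<le> \<pi> j" using y(2) pos_first[of i] by (simp add: order_of_def)
      qed
    next
      assume v: ?v
      show ?u
      proof (intro allI impI)
        fix y assume y: "y \<in> ?A" "block_pos k (i + 1, 1) < block_pos k y"
        then have "block_pos k y \<in> {Suc (i * k)<..?N}" using range[of y] unfolding pos_first by simp
        then have "\<pi> (Suc (i * k)) \<le> \<pi> (block_pos k y)" using v by blast
        then show "((i + 1, 1), y) \<in> ?l" using y(1) first[OF that] pos_first[of i] by (simp add: order_of_def)
      qed
    qed
    then have "?c \<longleftrightarrow> (\<forall>i. 1 \<le> i \<longrightarrow> i \<le> m \<longrightarrow> (\<forall>j\<in>{Suc (i * k)<..?N}. \<pi> (Suc (i * k)) \<le> \<pi> j))" by blast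
    also have "\<dots> \<longleftrightarrow> ?c'" using multiple before dvd_triv_right[of k] by blast
    finally show ?thesis .
  qed
  \<comment> \<open>Weak inequalities between neighbours are strict by injectivity; at an ascent the
    avoidance holds trivially.\<close>
  have point: "((\<not> k dvd p \<longrightarrow> \<pi> p \<le> \<pi> (Suc p)) \<and> (k dvd p \<longrightarrow> \<pi> (Suc p) \<le> \<pi> p) \<and>
      (k dvd p \<longrightarrow> (\<forall>j\<in>{Suc p<..?N}. \<pi> (Suc p) \<le> \<pi> j))) \<longleftrightarrow>
    ((\<pi> (Suc p) < \<pi> p \<longleftrightarrow> k dvd p) \<and> (\<forall>j\<in>{Suc p<..?N}. \<not> (\<pi> j < \<pi> (Suc p) \<and> \<pi> (Suc p) < \<pi> p)))" for p
  proof -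
    have "\<pi> p \<noteq> \<pi> (Suc p)" using permutes_neq[OF \<pi>] by simp
    then show ?thesis by (cases "k dvd p") (auto simp: not_less)
  qed
  have "k > 0" using assms(2) by simp
  have "P321 m s k \<subseteq> ?l \<longleftrightarrow> (\<forall>p\<in>{1..<?N}. (\<not> k dvd p \<longrightarrow> \<pi> p \<le> \<pi> (Suc p)) \<and> (k dvd p \<longrightarrow> \<pi> (Suc p) \<le> \<pi> p) \<and>
      (k dvd p \<longrightarrow> (\<forall>j\<in>{Suc p<..?N}. \<pi> (Suc p) \<le> \<pi> j)))"
    unfolding P321_subset_iff[OF l] A B C ball_conj_distrib ..
  then show ?thesis
    unfolding point D_avoiding_iff[OF \<open>k > 0\<close>] same_relative_order_patterns using \<pi> by blast
qed

lemma card_D_avoiding_321: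
  assumes "k \<ge> 2"
  shows "card (D_avoiding (m * k + s) k [3, 2, 1]) = LE (block_elems m s k) (P321 m s k)"
proof -
  let ?F = "order_of (block_pos k) (block_elems m s k)"
  have b: "bij_betw ?F {\<pi>. \<pi> permutes {1..m * k + s}} {l. linear_order_on (block_elems m s k) l}"
    by (rule bij_betw_order_of[OF bij_betw_block_pos])
  have D: "D_avoiding (m * k + s) k [3, 2, 1] = {\<pi>. \<pi> permutes {1..m * k + s} \<and> P321 m s k \<subseteq> ?F \<pi>}"
    using P321_subset_order_of_iff[OF _ assms] by (auto simp: D_avoiding_def D_def)
  have "?F ` D_avoiding (m * k + s) k [3, 2, 1] = linear_extensions (block_elems m s k) (P321 m s k)"
  proof -
    have "?F ` {\<pi>. \<pi> permutes {1..m * k + s} \<and> P321 m s k \<subseteq> ?F \<pi>}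
        = {l. l \<in> ?F ` {\<pi>. \<pi> permutes {1..m * k + s}} \<and> P321 m s k \<subseteq> l}" by blast
    then show ?thesis
      unfolding D linear_extensions_def bij_betw_imp_surj_on[OF b] mem_Collect_eq .
  qed
  moreover have "inj_on ?F (D_avoiding (m * k + s) k [3, 2, 1])"
    by (rule inj_on_subset[OF bij_betw_imp_inj_on[OF b]]) (unfold D, blast)
  ultimately show ?thesis
    unfolding LE_def using card_image[of ?F "D_avoiding (m * k + s) k [3, 2, 1]"] by (simp only:)
qed

end

section \<open>Assembling the six counts\<close>

theorem theorem5p7:
  fixes k m s N :: nat
  assumes "k \<ge> 2" and "1 \<le> s" and "s \<le> k" and "N = m * k + s"
  shows
    "(k \<ge> 3 \<and> N \<ge> 3 \<longrightarrow> card (D_avoiding N k [1, 2, 3]) = 0) \<and>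
     (k = 2 \<longrightarrow>
        card (D_avoiding (2 * m + 1) 2 [1, 2, 3]) = 2 ^ m * fact m \<and>
        card (D_avoiding (2 * m + 2) 2 [1, 2, 3]) = (\<Prod>j = 1..m. 2 * j + 1)) \<and>
     real (card (D_avoiding N k [1, 3, 2])) =
       real s / real (m * k + s) * real ((m * k + s) choose m) \<and>
     card (D_avoiding N k [2, 1, 3]) = (\<Prod>j = 1..m. (s + j * k - 1) choose (k - 1)) \<and>
     card (D_avoiding N k [2, 3, 1]) = (\<Prod>j < m. s + j * k) \<and>
     real (card (D_avoiding N k [3, 1, 2])) =
       1 / real ((k - 1) * (m + 1) + 1) * real ((k * (m + 1)) choose (m + 1)) \<and>
     card (D_avoiding N k [3, 2, 1]) = LE (block_elems m s k) (P321 m s k)"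
proof (intro conjI impI)
  show "card (D_avoiding N k [1, 2, 3]) = 0" if "k \<ge> 3 \<and> N \<ge> 3"
    using that D_avoiding_123_eq_empty[of k N] by simp
  show "card (D_avoiding (2 * m + 1) 2 [1, 2, 3]) = 2 ^ m * fact m"
  proof -
    \<comment> \<open>The 213 count for \<open>k = 2\<close>, \<open>s = 1\<close>: each binomial is
      \<open>2 * j choose 1\<close>.\<close>
    have "card (D_avoiding (2 * m + 1) 2 [1, 2, 3]) = (\<Prod>j=1..m. 2 * j)"
      unfolding D_avoiding_2_123 using card_D_avoiding_213[of 2 1 m] by (simp add: mult.commute)
    then show ?thesis by (simp add: prod.distrib fact_prod)
  qed
  show "card (D_avoiding (2 * m + 2) 2 [1, 2, 3]) = (\<Prod>j = 1..m. 2 * j + 1)"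
    unfolding D_avoiding_2_123 using card_D_avoiding_213[of 2 2 m] by (simp add: mult.commute)
  show "real (card (D_avoiding N k [1, 3, 2])) = real s / real (m * k + s) * real ((m * k + s) choose m)"
    using assms by (simp only: card_D_avoiding_132 raney_closed_form)
  show "card (D_avoiding N k [2, 1, 3]) = (\<Prod>j = 1..m. (s + j * k - 1) choose (k - 1))"
    using assms card_D_avoiding_213 by simp
  show "card (D_avoiding N k [2, 3, 1]) = (\<Prod>j < m. s + j * k)"
    using assms card_D_avoiding_231 by simp
  show "real (card (D_avoiding N k [3, 1, 2])) =
       1 / real ((k - 1) * (m + 1) + 1) * real ((k * (m + 1)) choose (m + 1))"
  proof -
    define K where "K = k * (m + 1)"
    have K: "m * k + k = K" "K = (k - 1) * (m + 1) + 1 + m"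
      using assms(1) unfolding K_def by (simp add: algebra_simps, cases k) simp_all
    \<comment> \<open>The Raney form gives \<open>1 / (m + 1) * (K choose m)\<close>; absorption
      exchanges this for the stated form with \<open>K choose (m + 1)\<close>.\<close>
    have "Suc m * (K choose Suc m) = (K - m) * (K choose m)"
      by (simp only: binomial_absorption binomial_absorb_comp)
    moreover have "K - m = (k - 1) * (m + 1) + 1" using K(2) by simp
    ultimately have "real (Suc m * (K choose Suc m)) = real (((k - 1) * (m + 1) + 1) * (K choose m))"
      by (simp only:)
    then have c: "real (Suc m) * real (K choose Suc m) = real ((k - 1) * (m + 1) + 1) * real (K choose m)"
      by (simp only: of_nat_mult)
    have frac: "real k / real K = 1 / real (Suc m)"
      unfolding K_def of_nat_mult Suc_eq_plus1
      by (rule nonzero_divide_mult_cancel_left) (use assms(1) in simp)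
    have "real (card (D_avoiding N k [3, 1, 2])) = real (raney k m k)"
      using assms card_D_avoiding_312 by simp
    also have "\<dots> = 1 / real (Suc m) * real (K choose m)"
    proof -
      have "K > 0" "k > 0" using assms(1) unfolding K_def by simp_all
      then show ?thesis using raney_closed_form[of m k k] unfolding K(1) frac by blast
    qed
    also have "\<dots> = 1 / real ((k - 1) * (m + 1) + 1) * real (K choose Suc m)"
    proof -
      have "1 / a * y = 1 / b * x" if "a * x = b * y" "a > 0" "b > 0" for a b x y :: real
        using that by (simp add: field_simps)
      from this[OF c] show ?thesis unfolding of_nat_0_less_iff by simp
    qed
    finally show ?thesis unfolding K_def by simp
  qed
  show "card (D_avoiding N k [3, 2, 1]) = LE (block_elems m s k) (P321 m s k)"
    using assms card_D_avoiding_321 by simp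
qed

end
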